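(* Let $G$ be a finite group and let $\rho$ be a faithful, absolutely irreducible integral representation of $G$. Then each $\rho$-decomposable principally polarized abelian variety is isomorphic, as a complex torus, to a product of elliptic curves.
   Context: An integral representation of $G$ is a $\mathbb ZG$-module that is free of finite rank over $\mathbb Z$. A principally polarized abelian variety (p.p.a.v.) is a pair $(X,H)$, where $X=V/\Lambda$ is a complex torus and $H$ is a positive definite Hermitian form on $V$ whose imaginary part is integer valued and unimodular on $\Lambda$. A p.p.a.v. has a $G$-action if $G$ is a subgroup of the group of automorphisms of the torus $X$ preserving $H$; then $G$ acts on $\Lambda$. For a faithful integral representation $\rho$ of $G$, a p.p.a.v. $(X=V/\Lambda,H)$ is $\rho$-decomposable if it has a $G$-action for which there is a direct sum decomposition $\Lambda=L_1\oplus L_2$ with $L_1,L_2$ both $G$-invariant and isotropic for $\Im H$, and with $L_1$ isomorphic as a $\mathbb ZG$-module to $\rho$. *)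

theory Defs
  imports "HOL-Analysis.Analysis" "HOL-Algebra.Bij" "HOL-Algebra.Free_Abelian_Groups"
    "HOL-Library.Poly_Mapping"
begin

section \<open>Integral representations\<close>

text \<open>A \<open>\<int>G\<close>-module is an abelian group \<open>M\<close> with an action of \<open>G\<close> by group automorphisms.
  The abelian group \<open>M\<close> is written multiplicatively, as \<open>free_Abelian_group\<close> is.\<close>

definition integral_rep ::
    "('g, 'a) monoid_scheme \<Rightarrow> ('m, 'b) monoid_scheme \<Rightarrow> ('g \<Rightarrow> 'm \<Rightarrow> 'm) \<Rightarrow> bool" where
  "integral_rep G M \<rho> \<longleftrightarrow>
     comm_group M \<and> (\<exists>r::nat. M \<cong> free_Abelian_group {..<r}) \<and> \<rho> \<in> hom G (AutoGroup M)"

definition faithful_rep :: "('g, 'a) monoid_scheme \<Rightarrow> ('g \<Rightarrow> 'm \<Rightarrow> 'm) \<Rightarrow> bool" where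
  "faithful_rep G \<rho> \<longleftrightarrow> inj_on \<rho> (carrier G)"

definition ZG_isomorphic ::
    "('g, 'a) monoid_scheme \<Rightarrow> ('m, 'b) monoid_scheme \<Rightarrow> ('g \<Rightarrow> 'm \<Rightarrow> 'm)
      \<Rightarrow> ('k, 'c) monoid_scheme \<Rightarrow> ('g \<Rightarrow> 'k \<Rightarrow> 'k) \<Rightarrow> bool" where
  "ZG_isomorphic G M \<rho> N \<sigma> \<longleftrightarrow>
     (\<exists>f \<in> iso M N. \<forall>g \<in> carrier G. \<forall>x \<in> carrier M. f (\<rho> g x) = \<sigma> g (f x))"

text \<open>The complex representation \<open>\<complex> \<otimes>\<^sub>\<int> M\<close> is the complex vector space of formal
  combinations of elements of \<open>M\<close> modulo the subspace \<open>tensor_rel M\<close>, where the class of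
  \<open>single x c\<close> is \<open>c \<otimes> x\<close>. (The relations \<open>(c + d) \<otimes> x = c \<otimes> x + d \<otimes> x\<close> hold already
  for formal combinations, and compatibility with \<open>\<int>\<close> follows from biadditivity.)\<close>

definition cscale :: "complex \<Rightarrow> ('m \<Rightarrow>\<^sub>0 complex) \<Rightarrow> ('m \<Rightarrow>\<^sub>0 complex)" where
  "cscale c f = Poly_Mapping.map ((*) c) f"

definition formal_comb :: "('m, 'b) monoid_scheme \<Rightarrow> ('m \<Rightarrow>\<^sub>0 complex) set" where
  "formal_comb M = {f. Poly_Mapping.keys f \<subseteq> carrier M}"

definition tensor_rel :: "('m, 'b) monoid_scheme \<Rightarrow> ('m \<Rightarrow>\<^sub>0 complex) set" where
  "tensor_rel M = module.span cscale
     {Poly_Mapping.single (x \<otimes>\<^bsub>M\<^esub> y) 1 - Poly_Mapping.single x 1 - Poly_Mapping.single y 1 | x y.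
        x \<in> carrier M \<and> y \<in> carrier M}"

definition formal_push :: "('m \<Rightarrow> 'm) \<Rightarrow> ('m \<Rightarrow>\<^sub>0 complex) \<Rightarrow> ('m \<Rightarrow>\<^sub>0 complex)" where
  "formal_push h f =
     (\<Sum>x \<in> Poly_Mapping.keys f. Poly_Mapping.single (h x) (Poly_Mapping.lookup f x))"

text \<open>Absolutely irreducible: \<open>\<complex> \<otimes>\<^sub>\<int> M\<close> is nonzero and has no proper nonzero \<open>G\<close>-stable
  complex subspace. Subspaces of the quotient are given by their preimages, i.e. by the
  subspaces \<open>W\<close> between \<open>tensor_rel M\<close> and \<open>formal_comb M\<close>.\<close>

definition absolutely_irreducible ::
    "('g, 'a) monoid_scheme \<Rightarrow> ('m, 'b) monoid_scheme \<Rightarrow> ('g \<Rightarrow> 'm \<Rightarrow> 'm) \<Rightarrow> bool" where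
  "absolutely_irreducible G M \<rho> \<longleftrightarrow>
     tensor_rel M \<noteq> formal_comb M \<and>
     (\<forall>W. module.subspace cscale W \<and> tensor_rel M \<subseteq> W \<and> W \<subseteq> formal_comb M \<and>
          (\<forall>g \<in> carrier G. formal_push (\<rho> g) ` W \<subseteq> W)
        \<longrightarrow> W = tensor_rel M \<or> W = formal_comb M)"

lemma vector_space_cscale: "vector_space cscale"
proof
  fix a b :: complex and x y :: "'m \<Rightarrow>\<^sub>0 complex"
  have l: "Poly_Mapping.lookup (cscale c f) k = c * Poly_Mapping.lookup f k"
    for c k and f :: "'m \<Rightarrow>\<^sub>0 complex"
    by (simp add: cscale_def map.rep_eq when_def)
  show "cscale a (x + y) = cscale a x + cscale a y"
    by (rule poly_mapping_eqI) (simp add: l lookup_add algebra_simps)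
  show "cscale (a + b) x = cscale a x + cscale b x"
    by (rule poly_mapping_eqI) (simp add: l lookup_add algebra_simps)
  show "cscale a (cscale b x) = cscale (a * b) x"
    by (rule poly_mapping_eqI) (simp add: l)
  show "cscale 1 x = x"
    by (rule poly_mapping_eqI) (simp add: l)
qed


section \<open>Complex tori\<close>

definition add_group :: "'v::ab_group_add monoid" where
  "add_group = \<lparr>carrier = UNIV, mult = (+), one = 0\<rparr>"

definition is_lattice :: "'v::euclidean_space set \<Rightarrow> bool" where
  "is_lattice \<Lambda> \<longleftrightarrow>
     (\<exists>B. independent B \<and> span B = UNIV \<and>
          \<Lambda> = range (\<lambda>c :: 'v \<Rightarrow> int. \<Sum>b\<in>B. of_int (c b) *\<^sub>R b))"

definition torus :: "'v::ab_group_add set \<Rightarrow> 'v set monoid" where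
  "torus \<Lambda> = add_group Mod \<Lambda>"

definition torus_proj :: "'v::ab_group_add set \<Rightarrow> 'v \<Rightarrow> 'v set" where
  "torus_proj \<Lambda> v = \<Lambda> #>\<^bsub>add_group\<^esub> v"

abbreviation clinear :: "(complex^'n \<Rightarrow> complex^'m) \<Rightarrow> bool" where
  "clinear \<equiv> Vector_Spaces.linear (*s) (*s)"

definition holomorphic_vec_on :: "(complex^'n \<Rightarrow> complex^'m) \<Rightarrow> (complex^'n) set \<Rightarrow> bool" where
  "holomorphic_vec_on F U \<longleftrightarrow> (\<forall>u\<in>U. \<exists>D. clinear D \<and> (F has_derivative D) (at u within U))"

text \<open>Holomorphy for the complex structures that make the projections
  \<open>\<complex>\<^sup>n \<rightarrow> \<complex>\<^sup>n/\<Lambda>\<close> and \<open>\<complex>\<^sup>m \<rightarrow> \<complex>\<^sup>m/\<Lambda>'\<close> local biholomorphisms: locally, the map lifts to a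
  holomorphic map of the covering spaces.\<close>

definition torus_holomorphic ::
    "(complex^'n) set \<Rightarrow> (complex^'m) set \<Rightarrow> ((complex^'n) set \<Rightarrow> (complex^'m) set) \<Rightarrow> bool" where
  "torus_holomorphic \<Lambda> \<Lambda>' \<phi> \<longleftrightarrow>
     (\<forall>v. \<exists>U F. open U \<and> v \<in> U \<and> holomorphic_vec_on F U \<and>
        (\<forall>u\<in>U. \<phi> (torus_proj \<Lambda> u) = torus_proj \<Lambda>' (F u)))"

definition torus_iso ::
    "(complex^'n) set \<Rightarrow> (complex^'m) set \<Rightarrow> ((complex^'n) set \<Rightarrow> (complex^'m) set) set" where
  "torus_iso \<Lambda> \<Lambda>' = {\<phi> \<in> iso (torus \<Lambda>) (torus \<Lambda>').
     torus_holomorphic \<Lambda> \<Lambda>' \<phi> \<and>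
     torus_holomorphic \<Lambda>' \<Lambda> (inv_into (carrier (torus \<Lambda>)) \<phi>)}"

definition torus_isomorphic :: "(complex^'n) set \<Rightarrow> (complex^'m) set \<Rightarrow> bool" where
  "torus_isomorphic \<Lambda> \<Lambda>' \<longleftrightarrow> torus_iso \<Lambda> \<Lambda>' \<noteq> {}"

text \<open>An elliptic curve is \<open>\<complex>/\<Lambda>\<^sub>i\<close> for a lattice \<open>\<Lambda>\<^sub>i\<close>, and
  \<open>\<complex>/\<Lambda>\<^sub>1 \<times> \<dots> \<times> \<complex>/\<Lambda>\<^sub>n = \<complex>\<^sup>n/(\<Lambda>\<^sub>1 \<times> \<dots> \<times> \<Lambda>\<^sub>n)\<close>.\<close>

definition product_lattice :: "('n \<Rightarrow> complex set) \<Rightarrow> (complex^'n) set" where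
  "product_lattice E = {v. \<forall>i. v $ i \<in> E i}"


section \<open>Principally polarized abelian varieties\<close>

definition pos_def_hermitian :: "(complex^'n \<Rightarrow> complex^'n \<Rightarrow> complex) \<Rightarrow> bool" where
  "pos_def_hermitian H \<longleftrightarrow>
     (\<forall>x y z. H (x + y) z = H x z + H y z) \<and>
     (\<forall>c x y. H (c *s x) y = c * H x y) \<and>
     (\<forall>x y. H y x = cnj (H x y)) \<and>
     (\<forall>x. x \<noteq> 0 \<longrightarrow> 0 < Re (H x x))"

text \<open>Unimodular: the pairing identifies \<open>\<Lambda>\<close> with its dual \<open>Hom(\<Lambda>, \<int>)\<close>.\<close>

definition unimodular_on :: "'v::ab_group_add set \<Rightarrow> ('v \<Rightarrow> 'v \<Rightarrow> real) \<Rightarrow> bool" where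
  "unimodular_on \<Lambda> E \<longleftrightarrow>
     (\<forall>f :: 'v \<Rightarrow> int. (\<forall>x\<in>\<Lambda>. \<forall>y\<in>\<Lambda>. f (x + y) = f x + f y) \<longrightarrow>
        (\<exists>!y. y \<in> \<Lambda> \<and> (\<forall>x\<in>\<Lambda>. E x y = of_int (f x))))"

definition ppav :: "(complex^'n) set \<Rightarrow> (complex^'n \<Rightarrow> complex^'n \<Rightarrow> complex) \<Rightarrow> bool" where
  "ppav \<Lambda> H \<longleftrightarrow> is_lattice \<Lambda> \<and> pos_def_hermitian H \<and>
     (\<forall>x\<in>\<Lambda>. \<forall>y\<in>\<Lambda>. Im (H x y) \<in> \<int>) \<and> unimodular_on \<Lambda> (\<lambda>x y. Im (H x y))"

text \<open>\<open>A\<close> is the linear map of \<open>V\<close> inducing \<open>\<phi>\<close> on \<open>V/\<Lambda>\<close> (unique, as \<open>\<Lambda>\<close> is discrete).\<close>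

definition linear_lift ::
    "(complex^'n) set \<Rightarrow> ((complex^'n) set \<Rightarrow> (complex^'n) set) \<Rightarrow> (complex^'n \<Rightarrow> complex^'n) \<Rightarrow> bool"
  where
  "linear_lift \<Lambda> \<phi> A \<longleftrightarrow> clinear A \<and> (\<forall>v. \<phi> (torus_proj \<Lambda> v) = torus_proj \<Lambda> (A v))"

definition ppav_Aut ::
    "(complex^'n) set \<Rightarrow> (complex^'n \<Rightarrow> complex^'n \<Rightarrow> complex)
      \<Rightarrow> ((complex^'n) set \<Rightarrow> (complex^'n) set) monoid" where
  "ppav_Aut \<Lambda> H = (AutoGroup (torus \<Lambda>)) \<lparr> carrier :=
     {\<phi> \<in> auto (torus \<Lambda>). \<phi> \<in> torus_iso \<Lambda> \<Lambda> \<and>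
        (\<exists>A. linear_lift \<Lambda> \<phi> A \<and> (\<forall>x y. H (A x) (A y) = H x y))} \<rparr>"

definition ppav_action ::
    "('g, 'a) monoid_scheme \<Rightarrow> (complex^'n) set \<Rightarrow> (complex^'n \<Rightarrow> complex^'n \<Rightarrow> complex)
      \<Rightarrow> ('g \<Rightarrow> (complex^'n) set \<Rightarrow> (complex^'n) set) \<Rightarrow> bool" where
  "ppav_action G \<Lambda> H \<alpha> \<longleftrightarrow> \<alpha> \<in> hom G (ppav_Aut \<Lambda> H) \<and> inj_on \<alpha> (carrier G)"

text \<open>The group element \<open>g\<close> acts on \<open>\<Lambda>\<close> through the linear lift \<open>A g\<close>.\<close>

definition rho_decomposable ::
    "('g, 'a) monoid_scheme \<Rightarrow> ('m, 'b) monoid_scheme \<Rightarrow> ('g \<Rightarrow> 'm \<Rightarrow> 'm)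
      \<Rightarrow> (complex^'n) set \<Rightarrow> (complex^'n \<Rightarrow> complex^'n \<Rightarrow> complex) \<Rightarrow> bool" where
  "rho_decomposable G M \<rho> \<Lambda> H \<longleftrightarrow>
     (\<exists>\<alpha> A L\<^sub>1 L\<^sub>2. ppav_action G \<Lambda> H \<alpha> \<and>
        (\<forall>g\<in>carrier G. linear_lift \<Lambda> (\<alpha> g) (A g)) \<and>
        subgroup L\<^sub>1 add_group \<and> subgroup L\<^sub>2 add_group \<and>
        \<Lambda> = {x + y | x y. x \<in> L\<^sub>1 \<and> y \<in> L\<^sub>2} \<and> L\<^sub>1 \<inter> L\<^sub>2 = {0} \<and>
        (\<forall>g\<in>carrier G. A g ` L\<^sub>1 \<subseteq> L\<^sub>1 \<and> A g ` L\<^sub>2 \<subseteq> L\<^sub>2) \<and>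
        (\<forall>x\<in>L\<^sub>1. \<forall>y\<in>L\<^sub>1. Im (H x y) = 0) \<and> (\<forall>x\<in>L\<^sub>2. \<forall>y\<in>L\<^sub>2. Im (H x y) = 0) \<and>
        ZG_isomorphic G M \<rho> (add_group \<lparr> carrier := L\<^sub>1 \<rparr>) A)"

end

theory Submission
  imports Defs "HOL-Computational_Algebra.Fundamental_Theorem_Algebra"
begin

text \<open>
  Let \<open>E = Im H\<close>. The two isotropic summands \<open>L\<^sub>1\<close> and \<open>L\<^sub>2\<close> are put in duality by the
  unimodular form \<open>E\<close>, so a \<open>\<int>\<close>-basis \<open>e\<close> of \<open>L\<^sub>1\<close> has a dual \<open>\<int>\<close>-basis \<open>f\<close> of \<open>L\<^sub>2\<close>
  (\<open>symplectic_basis_of_splitting\<close>). Positivity of \<open>H\<close> forces the real span of \<open>L\<^sub>1\<close> to meet its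
  multiple by \<open>\<i>\<close> in \<open>0\<close>, so that \<open>e\<close> is \<open>\<complex>\<close>-independent. A count of
  dimensions makes it a \<open>\<complex>\<close>-basis of \<open>V\<close>, and \<open>V\<close> is the complex representation
  \<open>\<complex> \<otimes> L\<^sub>1\<close> of \<open>G\<close>.

  Averaging over \<open>G\<close> gives an integral, positive definite, \<open>G\<close>-invariant bilinear form \<open>b\<close> on
  \<open>L\<^sub>1\<close>. By duality it is \<open>b x y = E x (S y)\<close> for a \<open>\<int>G\<close>-linear map \<open>S\<close> from \<open>L\<^sub>1\<close> to \<open>L\<^sub>2\<close>.
  The \<open>\<complex>\<close>-linear extension of \<open>S\<close> to \<open>V\<close> commutes with \<open>G\<close>; as \<open>\<rho>\<close> is absolutely irreducible,
  Schur's lemma makes it multiplication by a complex number \<open>z\<close>. Hence \<open>z L\<^sub>1 \<subseteq> L\<^sub>2\<close>, and \<open>z\<close> is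
  not real because \<open>E x (z x) = b x x > 0\<close> whereas \<open>E x x = 0\<close> (\<open>intertwiner_scalar\<close>).

  The theorem on elementary divisors provides \<open>\<int>\<close>-bases \<open>e'\<close> of \<open>L\<^sub>1\<close> and \<open>f'\<close> of \<open>L\<^sub>2\<close> with
  \<open>z e'\<^sub>i = d\<^sub>i f'\<^sub>i\<close>. In the complex coordinates given by \<open>e'\<close>, the lattice \<open>\<Lambda> = L\<^sub>1 \<oplus> L\<^sub>2\<close> becomes
  the product of the lattices \<open>\<int> + \<int> (z / d\<^sub>i)\<close> in \<open>\<complex>\<close>, so the torus is the product of the
  corresponding elliptic curves (\<open>lattice_torus_isomorphic_product\<close>).
\<close>

section \<open>Elementary divisors\<close>

definition zscale :: "int \<Rightarrow> 'v::real_vector \<Rightarrow> 'v" where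
  "zscale k x = of_int k *\<^sub>R x"

interpretation zmod: module zscale
  by unfold_locales (simp_all add: zscale_def algebra_simps)

lemma zspan_family:
  assumes "finite I" and "x \<in> zmod.span (f ` I)"
  obtains c where "x = (\<Sum>i\<in>I. zscale (c i) (f i))"
proof -
  let ?R = "range (\<lambda>c. \<Sum>i\<in>I. zscale (c i) (f i))"
  have "zmod.subspace ?R"
  proof (rule zmod.subspaceI)
    show "0 \<in> ?R" by (intro range_eqI[of _ _ "\<lambda>_. 0"]) simp
  next
    fix x y assume "x \<in> ?R" "y \<in> ?R"
    then obtain c d where "x = (\<Sum>i\<in>I. zscale (c i) (f i))" "y = (\<Sum>i\<in>I. zscale (d i) (f i))"
      by blast
    then show "x + y \<in> ?R"
      by (intro range_eqI[of _ _ "\<lambda>i. c i + d i"]) (simp add: sum.distrib zmod.scale_left_distrib)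
  next
    fix k x assume "x \<in> ?R"
    then obtain c where "x = (\<Sum>i\<in>I. zscale (c i) (f i))" by blast
    then show "zscale k x \<in> ?R"
      by (intro range_eqI[of _ _ "\<lambda>i. k * c i"]) (simp add: zmod.scale_sum_right)
  qed
  moreover have "f ` I \<subseteq> ?R"
  proof
    fix y assume "y \<in> f ` I"
    then obtain j where j: "j \<in> I" "y = f j" by blast
    have "y = (\<Sum>i\<in>I. if i = j then f i else 0)"
      using assms(1) j by (simp add: sum.delta)
    also have "\<dots> = (\<Sum>i\<in>I. zscale (if i = j then 1 else 0) (f i))"
      by (intro sum.cong) auto
    finally show "y \<in> ?R" by (rule range_eqI[of _ _ "\<lambda>i. if i = j then 1 else 0"])
  qed
  ultimately have "zmod.span (f ` I) \<subseteq> ?R" by (rule zmod.span_minimal[rotated])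
  with assms(2) that show thesis by blast
qed

lemma zspan_update_add:
  assumes "k \<in> I" and "y \<in> zmod.span (f ` (I - {k}))"
  shows "zmod.span (f(k := f k + y) ` I) = zmod.span (f ` I)"
proof -
  let ?f = "f(k := f k + y)"
  have img: "?f ` (I - {k}) = f ` (I - {k})" by auto
  have I: "I = insert k (I - {k})" using assms(1) by blast
  have "f k + y \<in> zmod.span (f ` I)"
  proof (rule zmod.span_add)
    show "f k \<in> zmod.span (f ` I)" using assms(1) by (intro zmod.span_base) auto
    show "y \<in> zmod.span (f ` I)" using assms(2) zmod.span_mono[of "f ` (I - {k})" "f ` I"] by auto
  qed
  then have 1: "?f ` I \<subseteq> zmod.span (f ` I)"
    by (auto intro: zmod.span_base)
  have y: "y \<in> zmod.span (?f ` I)"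
    using assms(2) zmod.span_mono[of "?f ` (I - {k})" "?f ` I"] unfolding img by auto
  have "f k + y \<in> zmod.span (?f ` I)"
    using assms(1) by (intro zmod.span_base) auto
  then have "f k \<in> zmod.span (?f ` I)"
    using zmod.span_diff[OF _ y] by fastforce
  moreover have "f i \<in> zmod.span (?f ` I)" if "i \<in> I" "i \<noteq> k" for i
    using that by (intro zmod.span_base) (auto simp: image_iff intro!: bexI[of _ i])
  ultimately have 2: "f ` I \<subseteq> zmod.span (?f ` I)" by auto
  show ?thesis using 1 2 by (simp add: zmod.span_eq)
qed

lemma zspan_insert_cong:
  assumes "zmod.span A = zmod.span B"
  shows "zmod.span (insert a A) = zmod.span (insert a B)"
  using assms by (simp add: zmod.span_insert)

text \<open>The Smith normal form, for generating families instead of matrices. Among all pairs of generating families, and all ways to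
  write an image \<open>T (e' j)\<close> in terms of \<open>f'\<close>, choose a nonzero coefficient \<open>c\<close> of least absolute value.
  Division with remainder followed by an elementary operation would produce a smaller one, so \<open>c\<close>
  divides every other coefficient in its row and column, and these can be cleared. The pivot splits
  off, and induction applies to the remaining families.\<close>

lemma elementary_divisors:
  fixes T :: "'v::real_vector \<Rightarrow> 'w::real_vector" and e :: "'i \<Rightarrow> 'v" and f :: "'i \<Rightarrow> 'w"
  assumes "finite I" and "module_hom zscale zscale T"
    and "\<And>i. i \<in> I \<Longrightarrow> T (e i) \<in> zmod.span (f ` I)"
  shows "\<exists>e' f' d. zmod.span (e' ` I) = zmod.span (e ` I) \<and> zmod.span (f' ` I) = zmod.span (f ` I) \<and>
           (\<forall>i\<in>I. T (e' i) = zscale (d i) (f' i))"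
  using assms(1,3)
proof (induction I arbitrary: e f rule: finite_psubset_induct)
  case (psubset I)
  interpret T: module_hom zscale zscale T by (rule assms(2))
  show ?case
  proof (cases "\<forall>i\<in>I. T (e i) = 0")
    case True
    then show ?thesis
      by (intro exI[of _ e] exI[of _ f] exI[of _ "\<lambda>_. 0"]) simp
  next
    case False
    define adm where "adm e' f' \<longleftrightarrow> zmod.span (e' ` I) = zmod.span (e ` I) \<and>
      zmod.span (f' ` I) = zmod.span (f ` I)" for e' f'
    \<comment> \<open>\<open>c\<close> is a possible coefficient of \<open>f' k\<close> in \<open>T (e' j)\<close>; it is not determined by the
      families when \<open>f'\<close> is linearly dependent.\<close>
    define entry where "entry e' f' j k c \<longleftrightarrow> adm e' f' \<and> j \<in> I \<and> k \<in> I \<and> c \<noteq> 0 \<and>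
      T (e' j) - zscale c (f' k) \<in> zmod.span (f' ` (I - {k}))" for e' f' j k c
    have adm_T: "T (e' i) \<in> zmod.span (f' ` I)" if "adm e' f'" "i \<in> I" for e' f' i
    proof -
      have "e' i \<in> zmod.span (e ` I)" using that zmod.span_base[of "e' i" "e' ` I"] by (auto simp: adm_def)
      then have "T (e' i) \<in> zmod.span (T ` e ` I)" using T.span_image by blast
      also have "\<dots> \<subseteq> zmod.span (f ` I)"
        using psubset.prems by (intro zmod.span_minimal) auto
      finally show ?thesis using that by (simp add: adm_def)
    qed
    have ex: "\<exists>e' f' j k c. entry e' f' j k c"
    proof -
      obtain j where j: "j \<in> I" "T (e j) \<noteq> 0" using False by blast
      obtain c where c: "T (e j) = (\<Sum>i\<in>I. zscale (c i) (f i))"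
        using zspan_family[OF psubset.hyps psubset.prems[OF j(1)]] .
      then obtain k where k: "k \<in> I" "c k \<noteq> 0" using j(2)
        by (metis (no_types, lifting) sum.neutral zmod.scale_zero_left)
      have "T (e j) - zscale (c k) (f k) = (\<Sum>i\<in>I - {k}. zscale (c i) (f i))"
        unfolding c using psubset.hyps k(1) by (simp add: sum.remove)
      also have "\<dots> \<in> zmod.span (f ` (I - {k}))"
        by (intro zmod.span_sum zmod.span_scale zmod.span_base) auto
      finally have "entry e f j k (c k)" using j k by (simp add: entry_def adm_def)
      then show ?thesis by blast
    qed
    define N where "N = (LEAST n. \<exists>e' f' j k c. entry e' f' j k c \<and> n = nat \<bar>c\<bar>)"
    have "\<exists>n e' f' j k c. entry e' f' j k c \<and> n = nat \<bar>c\<bar>" using ex by blast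
    then obtain e' f' j k c where ent: "entry e' f' j k c" and N: "N = nat \<bar>c\<bar>"
      using LeastI_ex[of "\<lambda>n. \<exists>e' f' j k c. entry e' f' j k c \<and> n = nat \<bar>c\<bar>"]
      unfolding N_def by blast
    have minimal: "nat \<bar>c\<bar> \<le> nat \<bar>c'\<bar>" if "entry e1 f1 j1 k1 c'" for e1 f1 j1 k1 c'
      unfolding N[symmetric] N_def using that by (intro Least_le) blast
    have small: "a = 0" if "adm e1 f1" "j1 \<in> I" "k1 \<in> I" "\<bar>a\<bar> < \<bar>c\<bar>"
      "T (e1 j1) - zscale a (f1 k1) \<in> zmod.span (f1 ` (I - {k1}))" for e1 f1 j1 k1 a
    proof (rule ccontr)
      assume "a \<noteq> 0"
      then have "nat \<bar>c\<bar> \<le> nat \<bar>a\<bar>" using minimal[of e1 f1 j1 k1 a] that by (simp add: entry_def)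
      with that(4) show False by linarith
    qed
    from ent have adm: "adm e' f'" and jI: "j \<in> I" and kI: "k \<in> I" and c0: "c \<noteq> 0"
      and Tj: "T (e' j) - zscale c (f' k) \<in> zmod.span (f' ` (I - {k}))"
      by (auto simp: entry_def)
    let ?F = "zmod.span (f' ` (I - {k}))"

    \<comment> \<open>Subtracting a multiple of \<open>e' j\<close> from \<open>e' i\<close> leaves a remainder modulo \<open>c\<close> as coefficient
      of \<open>f' k\<close>, which vanishes by minimality: the row of the pivot can be cleared.\<close>
    have "\<exists>q. T (e' i - zscale q (e' j)) \<in> ?F" if i: "i \<in> I" "i \<noteq> j" for i
    proof -
      have "insert (f' k) (f' ` (I - {k})) = f' ` I" using kI by blast
      then obtain a where a: "T (e' i) - zscale a (f' k) \<in> ?F"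
        using adm_T[OF adm i(1)] zmod.span_breakdown_eq[of "T (e' i)" "f' k" "f' ` (I - {k})"] by auto
      define q where "q = a div c"
      let ?e = "e'(i := e' i + zscale (- q) (e' j))"
      have "zmod.span (?e ` I) = zmod.span (e' ` I)"
        using i jI by (intro zspan_update_add zmod.span_scale zmod.span_base) auto
      then have "adm ?e f'" using adm by (simp only: adm_def)
      moreover have *: "T (?e i) - zscale (a mod c) (f' k) \<in> ?F"
      proof -
        have "T (?e i) - zscale (a mod c) (f' k)
          = (T (e' i) - zscale a (f' k)) - zscale q (T (e' j) - zscale c (f' k))"
        proof -
          have "zscale a (f' k) = zscale q (zscale c (f' k)) + zscale (a mod c) (f' k)"
            by (simp add: q_def flip: zmod.scale_left_distrib)
          then show ?thesis
            by (simp add: T.add T.scale T.neg T.diff zmod.scale_right_diff_distrib)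
        qed
        then show ?thesis using a Tj by (simp only: zmod.span_diff zmod.span_scale)
      qed
      ultimately have "a mod c = 0"
        using small[of ?e f' i k "a mod c"] i(1) kI c0 by (simp add: abs_mod_less)
      with * have "T (e' i - zscale q (e' j)) \<in> ?F" by simp
      then show ?thesis by blast
    qed
    then obtain q where q: "\<And>i. i \<in> I \<Longrightarrow> i \<noteq> j \<Longrightarrow> T (e' i - zscale (q i) (e' j)) \<in> ?F" by metis

    \<comment> \<open>Adding a multiple of \<open>f' l\<close> to \<open>f' k\<close> replaces the coefficient of \<open>f' l\<close> in \<open>T (e' j)\<close> by
      its remainder modulo \<open>c\<close>: the column of the pivot can be cleared.\<close>
    obtain y where y: "T (e' j) - zscale c (f' k) = (\<Sum>i\<in>I - {k}. zscale (y i) (f' i))"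
      using zspan_family[OF _ Tj] psubset.hyps by blast
    have dvd: "c dvd y l" if l: "l \<in> I - {k}" for l
    proof -
      let ?f = "f'(k := f' k + zscale (y l div c) (f' l))"
      have "zmod.span (?f ` I) = zmod.span (f' ` I)"
        using l kI by (intro zspan_update_add zmod.span_scale zmod.span_base) auto
      then have "adm e' ?f" using adm by (simp only: adm_def)
      moreover have "T (e' j) - zscale (y l mod c) (?f l) \<in> zmod.span (?f ` (I - {l}))"
      proof -
        have "T (e' j) = zscale c (f' k) + (zscale (y l) (f' l) + (\<Sum>i\<in>I - {k} - {l}. zscale (y i) (f' i)))"
          using y l psubset.hyps by (simp add: sum.remove[of _ l] algebra_simps)
        also have "zscale (y l) (f' l) = zscale c (zscale (y l div c) (f' l)) + zscale (y l mod c) (f' l)"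
          by (simp flip: zmod.scale_left_distrib)
        finally have "T (e' j) - zscale (y l mod c) (?f l)
          = zscale c (?f k) + (\<Sum>i\<in>I - {k} - {l}. zscale (y i) (?f i))"
          using l by (simp add: zmod.scale_right_distrib)
        also have "\<dots> \<in> zmod.span (?f ` (I - {l}))"
          using l kI by (intro zmod.span_add zmod.span_sum zmod.span_scale zmod.span_base imageI) auto
        finally show ?thesis .
      qed
      ultimately have "y l mod c = 0"
        using small[of e' ?f j l "y l mod c"] l jI c0 by (simp add: abs_mod_less)
      then show ?thesis by (simp add: dvd_eq_mod_eq_0)
    qed
    define w where "w = (\<Sum>i\<in>I - {k}. zscale (y i div c) (f' i))"
    define g where "g = f' k + w"
    have w: "w \<in> ?F" unfolding w_def by (intro zmod.span_sum zmod.span_scale zmod.span_base imageI)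
    have Tg: "T (e' j) = zscale c g"
    proof -
      have "zscale c w = (\<Sum>i\<in>I - {k}. zscale (y i) (f' i))"
        unfolding w_def zmod.scale_sum_right using dvd by (intro sum.cong) auto
      then show ?thesis using y by (simp add: g_def zmod.scale_right_distrib algebra_simps)
    qed

    \<comment> \<open>The pivot splits off. Its column has index \<open>j\<close> and its row index \<open>k\<close>; renaming the entry
      \<open>j\<close> of \<open>f'\<close> to \<open>k\<close> makes both remaining families be indexed by \<open>I - {j}\<close>.\<close>
    define e1 where "e1 i = e' i - zscale (q i) (e' j)" for i
    define f1 where "f1 i = (if i = k then f' j else f' i)" for i
    have f1: "f1 ` (I - {j}) = f' ` (I - {k})"
      using jI kI unfolding f1_def by (auto simp: image_iff split: if_splits)
    have "I - {j} \<subset> I" using jI by blast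
    moreover have "T (e1 i) \<in> zmod.span (f1 ` (I - {j}))" if "i \<in> I - {j}" for i
      using q that unfolding f1 e1_def by blast
    ultimately obtain e2 f2 d where
      e2: "zmod.span (e2 ` (I - {j})) = zmod.span (e1 ` (I - {j}))" and
      f2: "zmod.span (f2 ` (I - {j})) = zmod.span (f1 ` (I - {j}))" and
      d: "\<And>i. i \<in> I - {j} \<Longrightarrow> T (e2 i) = zscale (d i) (f2 i)"
      using psubset.IH[of "I - {j}" e1 f1] by blast
    have upd: "h(j := a) ` I = insert a (h ` (I - {j}))" for h :: "'i \<Rightarrow> 'z" and a
      using jI by auto
    have "zmod.span (e2(j := e' j) ` I) = zmod.span (insert (e' j) (e1 ` (I - {j})))"
      unfolding upd by (rule zspan_insert_cong[OF e2])
    also have "\<dots> = zmod.span (e' ` I)"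
    proof -
      have "e' i \<in> zmod.span (insert (e' j) (e1 ` (I - {j})))" if "i \<in> I" for i
      proof (cases "i = j")
        case False
        have "e1 i + zscale (q i) (e' j) \<in> zmod.span (insert (e' j) (e1 ` (I - {j})))"
          using that False by (intro zmod.span_add zmod.span_scale zmod.span_base) auto
        then show ?thesis by (simp add: e1_def)
      qed (simp add: zmod.span_base)
      moreover have "e1 i \<in> zmod.span (e' ` I)" if "i \<in> I" for i
        unfolding e1_def using that jI by (intro zmod.span_diff zmod.span_scale zmod.span_base) auto
      ultimately show ?thesis
        unfolding zmod.span_eq using jI by (auto intro: zmod.span_base)
    qed
    finally have E: "zmod.span (e2(j := e' j) ` I) = zmod.span (e ` I)"
      using adm by (simp add: adm_def)
    have "zmod.span (f2(j := g) ` I) = zmod.span (insert g (f' ` (I - {k})))"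
      unfolding upd by (rule zspan_insert_cong) (simp only: f2 f1)
    also have "insert g (f' ` (I - {k})) = f'(k := f' k + w) ` I"
      using kI by (auto simp: g_def)
    also have "zmod.span \<dots> = zmod.span (f' ` I)"
      by (rule zspan_update_add[OF kI w])
    finally have F: "zmod.span (f2(j := g) ` I) = zmod.span (f ` I)"
      using adm by (simp add: adm_def)
    have "\<forall>i\<in>I. T ((e2(j := e' j)) i) = zscale ((d(j := c)) i) ((f2(j := g)) i)"
      using d Tg by auto
    with E F show ?thesis
      by (intro exI[of _ "e2(j := e' j)"] exI[of _ "f2(j := g)"] exI[of _ "d(j := c)"] conjI)
  qed
qed

section \<open>Schur's lemma for absolutely irreducible integral representations\<close>

text \<open>In a finite-dimensional space some nonzero polynomial \<open>p\<close> satisfies \<open>p(T) v = 0\<close>. If \<open>p\<close> has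
  least degree and \<open>a\<close> is a root, with \<open>p = (X - a) q\<close>, then \<open>q(T) v\<close> is an eigenvector.\<close>

lemma eigenvector_exists:
  fixes T :: "complex^'n \<Rightarrow> complex^'n"
  assumes "clinear T"
  shows "\<exists>z v. v \<noteq> 0 \<and> T v = z *s v"
proof -
  interpret T: Vector_Spaces.linear "(*s)" "(*s)" T by (rule assms)
  define v :: "complex^'n" where "v = axis undefined 1"
  have v: "v \<noteq> 0" by (simp add: v_def axis_eq_0_iff)
  \<comment> \<open>\<open>ev p\<close> is \<open>p(T) v\<close>\<close>
  define ev where "ev p = fold_coeffs (\<lambda>a w. a *s v + T w) p 0" for p
  have ev_0 [simp]: "ev 0 = 0" by (simp add: ev_def)
  have ev_pCons [simp]: "ev (pCons a p) = a *s v + T (ev p)" for a p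
    by (cases "a = 0 \<and> p = 0") (auto simp: ev_def)
  have ev_add: "ev (p + q) = ev p + ev q" for p q
    by (induction p q rule: poly_induct2) (simp_all add: T.add vec.scale_left_distrib)
  have ev_smult: "ev (smult c p) = c *s ev p" for c p
    by (induction p) (simp_all add: T.scale vec.scale_right_distrib)
  have ev_sum: "ev (\<Sum>i\<in>S. p i) = (\<Sum>i\<in>S. ev (p i))" for p :: "nat \<Rightarrow> complex poly" and S
    by (induction S rule: infinite_finite_induct) (simp_all add: ev_add)
  have ev_root: "ev ([:- a, 1:] * p) = T (ev p) - a *s ev p" for a p
  proof -
    have "ev ([:- a, 1:] * p) = ev (pCons 0 p + smult (- a) p)" by simp
    also have "\<dots> = T (ev p) - a *s ev p" unfolding ev_add ev_smult by simp
    finally show ?thesis .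
  qed
  have "\<exists>p. p \<noteq> 0 \<and> ev p = 0"
  proof (rule ccontr)
    assume "\<not> ?thesis"
    then have nz: "p \<noteq> 0 \<Longrightarrow> ev p \<noteq> 0" for p by blast
    let ?w = "\<lambda>i::nat. ev (monom 1 i)" and ?I = "{..CARD('n)}"
    have lin: "c i = 0" if "(\<Sum>i\<in>?I. c i *s ?w i) = 0" "i \<in> ?I" for c i
    proof -
      have "ev (\<Sum>i\<in>?I. monom (c i) i) = (\<Sum>i\<in>?I. c i *s ?w i)"
        by (simp add: ev_sum smult_monom flip: ev_smult)
      then have "(\<Sum>i\<in>?I. monom (c i) i) = 0" using that(1) nz by metis
      then have "coeff (\<Sum>i\<in>?I. monom (c i) i) i = 0" by simp
      then show ?thesis using that(2) by (simp add: coeff_sum)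
    qed
    have inj: "inj_on ?w ?I"
    proof (rule inj_onI, rule ccontr)
      fix i j assume ij: "i \<in> ?I" "j \<in> ?I" "?w i = ?w j" "i \<noteq> j"
      have "ev (monom 1 i + smult (-1) (monom 1 j)) = 0"
        using ij(3) unfolding ev_add ev_smult by simp
      then have "monom 1 i + smult (-1) (monom 1 j) = (0 :: complex poly)" using nz by blast
      then have "coeff (monom 1 i + smult (-1) (monom 1 j)) i = (0 :: complex)" by simp
      then show False using ij(4) by simp
    qed
    have "vec.independent (?w ` ?I)"
      unfolding vec.dependent_finite[OF finite_imageI[OF finite_atMost]]
    proof (rule notI, elim exE conjE bexE)
      fix u x assume "x \<in> ?w ` ?I" "u x \<noteq> 0" and 0: "(\<Sum>x\<in>?w ` ?I. u x *s x) = 0"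
      then obtain i where i: "i \<in> ?I" "u (?w i) \<noteq> 0" by blast
      have "(\<Sum>i\<in>?I. u (?w i) *s ?w i) = 0" using 0 by (simp add: sum.reindex[OF inj])
      from lin[OF this i(1)] i(2) show False by simp
    qed
    then have "card (?w ` ?I) \<le> vec.dim (UNIV :: (complex^'n) set)"
      by (intro vec.independent_card_le_dim) auto
    then show False by (simp add: card_image[OF inj] vec.dim_UNIV vec.dimension_def card_cart_basis)
  qed
  then obtain p where p: "p \<noteq> 0" "ev p = 0"
    and least: "\<And>q. q \<noteq> 0 \<Longrightarrow> ev q = 0 \<Longrightarrow> degree p \<le> degree q"
    using ex_has_least_nat[of "\<lambda>p. p \<noteq> 0 \<and> ev p = 0" _ degree] by blast
  have "degree p \<noteq> 0"
  proof
    assume "degree p = 0"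
    then obtain c where "p = [:c:]" using degree_eq_zeroE by blast
    with p v show False by simp
  qed
  then obtain a where "poly p a = 0"
    using fundamental_theorem_of_algebra[of p] constant_degree[of p] by auto
  then obtain q where q: "p = [:- a, 1:] * q" unfolding poly_eq_0_iff_dvd dvd_def by blast
  with p(1) have q0: "q \<noteq> 0" by auto
  have "degree p = Suc (degree q)" unfolding q using q0 by (subst degree_mult_eq) auto
  with least[OF q0] have "ev q \<noteq> 0" by auto
  moreover have "T (ev q) = a *s ev q" using p(2) unfolding q ev_root by simp
  ultimately show ?thesis by blast
qed

text \<open>The map \<open>\<theta>\<close> exhibits \<open>\<complex>\<^sup>n\<close> as a quotient of \<open>\<complex> \<otimes> M\<close>. An eigenspace of \<open>T\<close> is a \<open>G\<close>-stable
  subspace of it, and its preimage in the formal combinations is one of the subspaces that occur in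
  the definition of absolute irreducibility. It is not \<open>tensor_rel M\<close>, which maps to \<open>0\<close>, so it is
  everything.\<close>

lemma absolutely_irreducible_scalar:
  fixes \<theta> :: "'m \<Rightarrow> complex^'n" and A :: "'g \<Rightarrow> complex^'n \<Rightarrow> complex^'n"
  assumes irr: "absolutely_irreducible G M \<rho>"
    and closed: "\<And>x y. x \<in> carrier M \<Longrightarrow> y \<in> carrier M \<Longrightarrow> x \<otimes>\<^bsub>M\<^esub> y \<in> carrier M"
    and \<rho>: "\<And>g x. g \<in> carrier G \<Longrightarrow> x \<in> carrier M \<Longrightarrow> \<rho> g x \<in> carrier M"
    and \<theta>_add: "\<And>x y. x \<in> carrier M \<Longrightarrow> y \<in> carrier M \<Longrightarrow> \<theta> (x \<otimes>\<^bsub>M\<^esub> y) = \<theta> x + \<theta> y"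
    and \<theta>_equiv: "\<And>g x. g \<in> carrier G \<Longrightarrow> x \<in> carrier M \<Longrightarrow> \<theta> (\<rho> g x) = A g (\<theta> x)"
    and gen: "vec.span (\<theta> ` carrier M) = UNIV"
    and A: "\<And>g. g \<in> carrier G \<Longrightarrow> clinear (A g)"
    and T: "clinear T" and comm: "\<And>g v. g \<in> carrier G \<Longrightarrow> T (A g v) = A g (T v)"
  shows "\<exists>z. \<forall>v. T v = z *s v"
proof -
  interpret pm: vector_space cscale by (rule vector_space_cscale)
  interpret T: Vector_Spaces.linear "(*s)" "(*s)" T by (rule T)
  \<comment> \<open>the linear extension of \<open>\<theta>\<close> to formal combinations\<close>
  define \<Phi> where "\<Phi> f = (\<Sum>x\<in>Poly_Mapping.keys f. Poly_Mapping.lookup f x *s \<theta> x)" for f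
  have lookup_cscale: "Poly_Mapping.lookup (cscale c f) k = c * Poly_Mapping.lookup f k"
    for c k and f :: "'m \<Rightarrow>\<^sub>0 complex"
    by (simp add: cscale_def map.rep_eq when_def)
  have \<Phi>_eq: "\<Phi> f = (\<Sum>x\<in>S. Poly_Mapping.lookup f x *s \<theta> x)"
    if "finite S" "Poly_Mapping.keys f \<subseteq> S" for f S
    unfolding \<Phi>_def using that by (intro sum.mono_neutral_left) (auto simp: in_keys_iff)
  have \<Phi>_add: "\<Phi> (f + h) = \<Phi> f + \<Phi> h" for f h
    using \<Phi>_eq[of "Poly_Mapping.keys f \<union> Poly_Mapping.keys h"] Poly_Mapping.keys_add[of f h]
    by (simp add: lookup_add vec.scale_left_distrib sum.distrib)
  have \<Phi>_scale: "\<Phi> (cscale c f) = c *s \<Phi> f" for c f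
    using \<Phi>_eq[of "Poly_Mapping.keys f" "cscale c f"] \<Phi>_eq[of "Poly_Mapping.keys f" f]
    by (auto simp: lookup_cscale vec.scale_sum_right in_keys_iff subset_iff)
  interpret \<Phi>: module_hom cscale "(*s)" \<Phi>
    by (intro module_hom.intro module_hom_axioms.intro pm.module_axioms vec.module_axioms
          \<Phi>_add \<Phi>_scale)
  have \<Phi>_single: "\<Phi> (Poly_Mapping.single x c) = c *s \<theta> x" for x c
    using \<Phi>_eq[of "{x}" "Poly_Mapping.single x c"] by simp
  have \<Phi>_push: "\<Phi> (formal_push (\<rho> g) f) = A g (\<Phi> f)" if g: "g \<in> carrier G" and f: "f \<in> formal_comb M" for g f
  proof -
    interpret A: Vector_Spaces.linear "(*s)" "(*s)" "A g" by (rule A[OF g])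
    have "\<Phi> (formal_push (\<rho> g) f) = (\<Sum>x\<in>Poly_Mapping.keys f. Poly_Mapping.lookup f x *s \<theta> (\<rho> g x))"
      by (simp add: formal_push_def \<Phi>.sum \<Phi>_single)
    also have "\<dots> = (\<Sum>x\<in>Poly_Mapping.keys f. Poly_Mapping.lookup f x *s A g (\<theta> x))"
      using f \<theta>_equiv[OF g] by (intro sum.cong) (auto simp: formal_comb_def)
    also have "\<dots> = A g (\<Phi> f)" by (simp add: \<Phi>_def A.sum A.scale)
    finally show ?thesis .
  qed
  have comb: "pm.subspace (formal_comb M)"
  proof (rule pm.subspaceI)
    show "f + h \<in> formal_comb M" if "f \<in> formal_comb M" "h \<in> formal_comb M" for f h
      using that Poly_Mapping.keys_add[of f h] by (auto simp: formal_comb_def)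
    show "cscale c f \<in> formal_comb M" if "f \<in> formal_comb M" for c f
      using that by (auto simp: formal_comb_def in_keys_iff lookup_cscale subset_iff)
  qed (simp add: formal_comb_def)
  have push_comb: "formal_push (\<rho> g) f \<in> formal_comb M" if g: "g \<in> carrier G" and f: "f \<in> formal_comb M" for g f
    unfolding formal_push_def
    using f \<rho>[OF g] by (intro pm.subspace_sum[OF comb]) (auto simp: formal_comb_def)
  have single_comb: "Poly_Mapping.single x c \<in> formal_comb M" if "x \<in> carrier M" for x c
    using that by (auto simp: formal_comb_def)
  have rel: "tensor_rel M \<subseteq> {f \<in> formal_comb M. \<Phi> f = 0}" (is "_ \<subseteq> ?N")
    unfolding tensor_rel_def
  proof (rule pm.span_minimal)
    show "pm.subspace ?N"
      using pm.subspace_inter[OF comb \<Phi>.subspace_kernel] by (simp add: Int_def)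
    show "{Poly_Mapping.single (x \<otimes>\<^bsub>M\<^esub> y) 1 - Poly_Mapping.single x 1 - Poly_Mapping.single y 1 | x y.
        x \<in> carrier M \<and> y \<in> carrier M} \<subseteq> ?N"
      using pm.subspace_diff[OF comb] single_comb closed
      by (auto simp: \<Phi>.diff \<Phi>_single \<theta>_add)
  qed
  have onto: "\<exists>f \<in> formal_comb M. \<Phi> f = v" for v
  proof -
    have "vec.subspace (\<Phi> ` formal_comb M)" by (rule \<Phi>.subspace_image[OF comb])
    moreover have "\<theta> ` carrier M \<subseteq> \<Phi> ` formal_comb M"
    proof
      fix w assume "w \<in> \<theta> ` carrier M"
      then obtain x where "x \<in> carrier M" "w = \<theta> x" by blast
      then show "w \<in> \<Phi> ` formal_comb M"
        using single_comb by (intro image_eqI[of _ _ "Poly_Mapping.single x 1"]) (simp_all add: \<Phi>_single)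
    qed
    ultimately have "vec.span (\<theta> ` carrier M) \<subseteq> \<Phi> ` formal_comb M"
      by (rule vec.span_minimal[rotated])
    then have "v \<in> \<Phi> ` formal_comb M" unfolding gen by (rule subsetD) (rule UNIV_I)
    then show ?thesis by (auto simp only: image_iff)
  qed

  obtain z v where zv: "v \<noteq> 0" "T v = z *s v" using eigenvector_exists[OF T] by blast
  define W where "W = {f \<in> formal_comb M. T (\<Phi> f) = z *s \<Phi> f}"
  have "pm.subspace W"
    unfolding W_def
    using comb
    by (auto simp: pm.subspace_def \<Phi>.add \<Phi>.scale T.add T.scale vec.scale_right_distrib mult.commute)
  moreover have "tensor_rel M \<subseteq> W" using rel by (auto simp: W_def)
  moreover have "W \<subseteq> formal_comb M" by (auto simp: W_def)
  moreover have "formal_push (\<rho> g) ` W \<subseteq> W" if g: "g \<in> carrier G" for g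
  proof -
    interpret A: Vector_Spaces.linear "(*s)" "(*s)" "A g" by (rule A[OF g])
    show ?thesis using push_comb[OF g] \<Phi>_push[OF g] comm[OF g] by (auto simp: W_def A.scale)
  qed
  ultimately have "W = tensor_rel M \<or> W = formal_comb M"
    using irr unfolding absolutely_irreducible_def by blast
  moreover have "W \<noteq> tensor_rel M"
    using onto[of v] zv rel by (auto simp: W_def)
  ultimately have W: "W = formal_comb M" by blast
  have "T v = z *s v" for v
    using onto[of v] unfolding W[symmetric] by (auto simp: W_def)
  then show ?thesis by blast
qed

section \<open>Isomorphisms of complex tori\<close>

lemma scaleR_conv_vector_smult: "r *\<^sub>R v = complex_of_real r *s v" for v :: "complex^'n"
  unfolding vec_eq_iff vector_scaleR_component vector_smult_component
  by (simp add: scaleR_conv_of_real)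

lemma clinear_linear:
  fixes P :: "complex^'n \<Rightarrow> complex^'m"
  assumes "clinear P" shows "linear P"
proof -
  interpret P: Vector_Spaces.linear "(*s)" "(*s)" P by (rule assms)
  show ?thesis by (intro linearI) (simp_all add: P.add P.scale scaleR_conv_vector_smult)
qed

lemma torus_proj_eq: "torus_proj \<Lambda> v = (\<lambda>x. x + v) ` \<Lambda>"
  by (auto simp: torus_proj_def r_coset_def add_group_def)

lemma carrier_torus: "carrier (torus \<Lambda>) = range (torus_proj \<Lambda>)"
  by (auto simp: torus_def carrier_FactGroup torus_proj_def add_group_def)

lemma mult_torus: "X \<otimes>\<^bsub>torus \<Lambda>\<^esub> Y = {x + y | x y. x \<in> X \<and> y \<in> Y}"
  by (auto simp: torus_def FactGroup_def set_mult_def add_group_def)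

lemma torus_holomorphic_clinear:
  assumes "clinear P" and "\<And>v. \<phi> (torus_proj \<Lambda> v) = torus_proj \<Lambda>' (P v)"
  shows "torus_holomorphic \<Lambda> \<Lambda>' \<phi>"
proof -
  have "(P has_derivative P) (at u)" for u
    using clinear_linear[OF assms(1)] bounded_linear_imp_has_derivative linear_conv_bounded_linear by blast
  then have "holomorphic_vec_on P UNIV"
    using assms(1) by (auto simp: holomorphic_vec_on_def)
  then show ?thesis
    unfolding torus_holomorphic_def using assms(2) by (metis UNIV_I open_UNIV)
qed

lemma torus_isomorphic_clinear:
  fixes P :: "complex^'n \<Rightarrow> complex^'m"
  assumes P: "clinear P" and Q: "clinear Q" and QP: "\<And>v. Q (P v) = v" and PQ: "\<And>w. P (Q w) = w"
    and im: "P ` \<Lambda> = \<Lambda>'"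
  shows "torus_isomorphic \<Lambda> \<Lambda>'"
proof -
  interpret P: Vector_Spaces.linear "(*s)" "(*s)" P by (rule P)
  interpret Q: Vector_Spaces.linear "(*s)" "(*s)" Q by (rule Q)
  have P_proj: "P ` torus_proj \<Lambda> v = torus_proj \<Lambda>' (P v)" for v
    by (auto simp: torus_proj_eq P.add image_iff simp flip: im)
  have Q_proj: "Q ` torus_proj \<Lambda>' w = torus_proj \<Lambda> (Q w)" for w
  proof -
    have "Q ` torus_proj \<Lambda>' w = Q ` P ` torus_proj \<Lambda> (Q w)" by (simp only: P_proj PQ)
    then show ?thesis by (simp add: image_image QP)
  qed
  have bij: "bij_betw ((`) P) (carrier (torus \<Lambda>)) (carrier (torus \<Lambda>'))"
    by (intro bij_betw_byWitness[where f' = "(`) Q"]) 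
      (auto simp: carrier_torus P_proj Q_proj image_image PQ QP)
  have "(`) P \<in> hom (torus \<Lambda>) (torus \<Lambda>')"
  proof (rule homI)
    show "P ` X \<in> carrier (torus \<Lambda>')" if "X \<in> carrier (torus \<Lambda>)" for X
      using that by (auto simp: carrier_torus P_proj)
    show "P ` (X \<otimes>\<^bsub>torus \<Lambda>\<^esub> Y) = P ` X \<otimes>\<^bsub>torus \<Lambda>'\<^esub> P ` Y" for X Y
    proof (intro equalityI subsetI)
      fix w assume "w \<in> P ` X \<otimes>\<^bsub>torus \<Lambda>'\<^esub> P ` Y"
      then obtain x y where "x \<in> X" "y \<in> Y" "w = P (x + y)" by (auto simp: mult_torus P.add)
      then show "w \<in> P ` (X \<otimes>\<^bsub>torus \<Lambda>\<^esub> Y)" by (auto simp: mult_torus)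
    next
      fix w assume "w \<in> P ` (X \<otimes>\<^bsub>torus \<Lambda>\<^esub> Y)"
      then obtain x y where "x \<in> X" "y \<in> Y" "w = P x + P y" by (auto simp: mult_torus P.add)
      then show "w \<in> P ` X \<otimes>\<^bsub>torus \<Lambda>'\<^esub> P ` Y" by (auto simp: mult_torus)
    qed
  qed
  with bij have iso: "(`) P \<in> iso (torus \<Lambda>) (torus \<Lambda>')" by (simp add: iso_def)
  have inv: "inv_into (carrier (torus \<Lambda>)) ((`) P) (torus_proj \<Lambda>' w) = torus_proj \<Lambda> (Q w)" for w
    using bij by (intro inv_into_f_eq) (auto simp: bij_betw_def carrier_torus P_proj PQ)
  have "(`) P \<in> torus_iso \<Lambda> \<Lambda>'"
    using iso torus_holomorphic_clinear[OF P, of "(`) P" \<Lambda> \<Lambda>', OF P_proj]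
      torus_holomorphic_clinear[OF Q, of "inv_into (carrier (torus \<Lambda>)) ((`) P)" \<Lambda>' \<Lambda>, OF inv]
    by (simp add: torus_iso_def)
  then show ?thesis by (auto simp: torus_isomorphic_def)
qed

text \<open>As \<open>\<tau>\<close> is not real, \<open>1\<close> and \<open>\<tau>\<close> form a real basis of \<open>\<complex>\<close>. This is the lattice of an
  elliptic curve with period ratio \<open>\<tau>\<close>.\<close>

lemma is_lattice_nonreal:
  fixes \<tau> :: complex
  assumes "Im \<tau> \<noteq> 0"
  shows "is_lattice {of_int a + of_int b * \<tau> | a b. True}"
proof -
  have ne: "\<tau> \<noteq> 1" using assms by auto
  have indep: "independent {1, \<tau>}"
  proof -
    have "\<tau> \<notin> span {1}"
      using assms by (auto simp: span_singleton)
    then have "independent {\<tau>, 1}" by (intro independent_insertI independent_empty) auto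
    then show ?thesis by (simp add: insert_commute)
  qed
  have "span {1, \<tau>} = UNIV"
    using card_ge_dim_independent[of "{1, \<tau>}" UNIV] indep ne by (auto simp: card_insert_if)
  moreover have "{of_int a + of_int b * \<tau> | a b. True}
      = range (\<lambda>c :: complex \<Rightarrow> int. \<Sum>x\<in>{1, \<tau>}. of_int (c x) *\<^sub>R x)" (is "?L = range ?s")
  proof (intro equalityI subsetI)
    fix x assume "x \<in> ?L"
    then obtain a b where x: "x = of_int a + of_int b * \<tau>" by blast
    have "x = ?s ((\<lambda>_. a)(\<tau> := b))" using ne by (simp add: x scaleR_conv_of_real)
    then show "x \<in> range ?s" by (rule range_eqI[of _ ?s])
  next
    fix x assume "x \<in> range ?s"
    then obtain c where "x = ?s c" by blast
    then have "x = of_int (c 1) + of_int (c \<tau>) * \<tau>" using ne by (simp add: scaleR_conv_of_real)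
    then show "x \<in> ?L" by blast
  qed
  ultimately show ?thesis unfolding is_lattice_def using indep by blast
qed

section \<open>Symplectic bases for the imaginary part of a Hermitian form\<close>

locale hermitian_form =
  fixes H :: "complex^'n \<Rightarrow> complex^'n \<Rightarrow> complex"
  assumes pos_def: "pos_def_hermitian H"
begin

definition E :: "complex^'n \<Rightarrow> complex^'n \<Rightarrow> real" where
  "E x y = Im (H x y)"

lemma H_add_left: "H (x + y) z = H x z + H y z"
  and H_scale_left: "H (c *s x) y = c * H x y"
  and H_cnj: "H y x = cnj (H x y)"
  and H_pos: "x \<noteq> 0 \<Longrightarrow> 0 < Re (H x x)"
  using pos_def unfolding pos_def_hermitian_def by blast+

lemma H_add_right: "H x (y + z) = H x y + H x z"
  using H_cnj[of x "y + z"] H_cnj[of x y] H_cnj[of x z] by (simp add: H_add_left)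

lemma H_scale_right: "H x (c *s y) = cnj c * H x y"
  using H_cnj[of x "c *s y"] H_cnj[of x y] by (simp add: H_scale_left)

lemma E_skew: "E y x = - E x y"
  using H_cnj[of y x] by (simp add: E_def)

lemma E_linear_left: "linear (\<lambda>x. E x y)"
  by (intro linearI) (simp_all add: E_def H_add_left H_scale_left scaleR_conv_vector_smult)

lemma E_linear_right: "linear (E x)"
  by (intro linearI) (simp_all add: E_def H_add_right H_scale_right scaleR_conv_vector_smult)

lemmas E_add_left = linear_add[OF E_linear_left]
  and E_add_right = linear_add[OF E_linear_right]
  and E_scaleR_left = linear_scale[OF E_linear_left, simplified]
  and E_scaleR_right = linear_scale[OF E_linear_right, simplified]
  and E_sum_left = linear_sum[OF E_linear_left]
  and E_sum_right = linear_sum[OF E_linear_right]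
  and E_diff_right = linear_diff[OF E_linear_right]
  and E_zero_right = linear_0[OF E_linear_right]

text \<open>This ties the complex structure to \<open>E\<close>: with \<open>z = \<i>\<close> it shows that a vector \<open>x \<noteq> 0\<close> is never
  \<open>E\<close>-orthogonal to \<open>\<i> x\<close>, and in general that \<open>z\<close> is not real as soon as \<open>x\<close> and \<open>z x\<close> are not
  \<open>E\<close>-orthogonal.\<close>

lemma E_scale_self: "E x (z *s x) = - Im z * Re (H x x)"
  using H_cnj[of x x] by (simp add: E_def H_scale_right complex_eq_iff)

end

text \<open>The two halves of the basis generate isotropic subgroups that \<open>E\<close> puts in duality.
  The index set is a parameter because the number of basis vectors in each half is only found to be the
  complex dimension in \<open>card_I\<close>.\<close>

locale symplectic_basis = hermitian_form H for H :: "complex^'n \<Rightarrow> complex^'n \<Rightarrow> complex" +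
  fixes I :: "'i set" and e f :: "'i \<Rightarrow> complex^'n"
  assumes fin: "finite I"
    and E_ee: "\<And>i j. i \<in> I \<Longrightarrow> j \<in> I \<Longrightarrow> E (e i) (e j) = 0"
    and E_ff: "\<And>i j. i \<in> I \<Longrightarrow> j \<in> I \<Longrightarrow> E (f i) (f j) = 0"
    and E_ef: "\<And>i j. i \<in> I \<Longrightarrow> j \<in> I \<Longrightarrow> E (e i) (f j) = (if i = j then 1 else 0)"
    and spanning: "span (e ` I \<union> f ` I) = UNIV"
begin

lemma E_fe: "i \<in> I \<Longrightarrow> j \<in> I \<Longrightarrow> E (f i) (e j) = (if i = j then - 1 else 0)"
  using E_skew[of "f i" "e j"] E_ef[of j i] by auto

lemma zspan_e_coord:
  assumes "x \<in> zmod.span (e ` I)"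
  shows "x = (\<Sum>i\<in>I. E x (f i) *\<^sub>R e i)" and "i \<in> I \<Longrightarrow> E x (f i) \<in> \<int>"
proof -
  obtain c where c: "x = (\<Sum>i\<in>I. zscale (c i) (e i))" using zspan_family[OF fin assms] .
  have "E x (f j) = of_int (c j)" if "j \<in> I" for j
    using that fin by (simp add: c zscale_def E_sum_left E_scaleR_left E_ef if_distrib cong: if_cong)
  then show "x = (\<Sum>i\<in>I. E x (f i) *\<^sub>R e i)" and "i \<in> I \<Longrightarrow> E x (f i) \<in> \<int>"
    by (subst c, auto simp: zscale_def)
qed

lemma zspan_f_coord:
  assumes "x \<in> zmod.span (f ` I)"
  shows "x = (\<Sum>i\<in>I. E (e i) x *\<^sub>R f i)"
proof -
  obtain c where c: "x = (\<Sum>i\<in>I. zscale (c i) (f i))" using zspan_family[OF fin assms] .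
  have "E (e j) x = of_int (c j)" if "j \<in> I" for j
    using that fin by (simp add: c zscale_def E_sum_right E_scaleR_right E_ef if_distrib cong: if_cong)
  then show ?thesis by (subst c) (auto simp: zscale_def)
qed

text \<open>A complex relation splits as \<open>x + \<i> y = 0\<close> with \<open>x\<close> and \<open>y\<close> in the real span of \<open>e\<close>. This span is
  isotropic, so \<open>y\<close> is \<open>E\<close>-orthogonal to \<open>\<i> y = - x\<close> and hence \<open>0\<close>; pairing with \<open>f\<close> then gives the
  coefficients.\<close>

lemma e_cindependent:
  assumes "(\<Sum>i\<in>I. c i *s e i) = 0" and "i \<in> I"
  shows "c i = 0"
proof -
  let ?x = "\<Sum>i\<in>I. Re (c i) *\<^sub>R e i" and ?y = "\<Sum>i\<in>I. Im (c i) *\<^sub>R e i"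
  have "c i *s e i = Re (c i) *\<^sub>R e i + \<i> *s (Im (c i) *\<^sub>R e i)" for i
    unfolding scaleR_conv_vector_smult vector_smult_assoc vec.scale_left_distrib[symmetric]
    by (simp flip: complex_eq)
  then have sum0: "?x + \<i> *s ?y = 0"
    using assms(1) by (simp add: sum.distrib vec.scale_sum_right)
  have "E ?y ?x = 0" "E ?y ?y = 0"
    by (simp_all add: E_sum_left E_sum_right E_scaleR_left E_scaleR_right E_ee)
  then have "E ?y (\<i> *s ?y) = 0"
    using arg_cong[OF sum0, of "E ?y"] by (simp add: E_add_right E_zero_right)
  then have y: "?y = 0" using H_pos[of ?y] by (auto simp: E_scale_self)
  with sum0 have x: "?x = 0" by simp
  have "Im (c i) = 0"
    using arg_cong[OF y, of "E (f i)"] assms(2) fin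
    by (simp add: E_sum_right E_scaleR_right E_fe E_zero_right if_distrib cong: if_cong)
  moreover have "Re (c i) = 0"
    using arg_cong[OF x, of "E (f i)"] assms(2) fin
    by (simp add: E_sum_right E_scaleR_right E_fe E_zero_right if_distrib cong: if_cong)
  ultimately show ?thesis by (simp add: complex_eq_iff)
qed

lemma inj_e: "inj_on e I"
proof (rule inj_onI, rule ccontr)
  fix i j assume "i \<in> I" "j \<in> I" "e i = e j" "i \<noteq> j"
  then show False using E_ef[of i i] E_ef[of j i] by simp
qed

lemma independent_e: "vec.independent (e ` I)"
  unfolding vec.dependent_finite[OF finite_imageI[OF fin]]
proof (rule notI, elim exE conjE bexE)
  fix u x assume "x \<in> e ` I" "u x \<noteq> 0" and 0: "(\<Sum>x\<in>e ` I. u x *s x) = 0"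
  then obtain i where i: "i \<in> I" "u (e i) \<noteq> 0" by blast
  have "(\<Sum>i\<in>I. u (e i) *s e i) = 0" using 0 by (simp add: sum.reindex[OF inj_e])
  from e_cindependent[OF this i(1)] i(2) show False by simp
qed

text \<open>Complex independence of \<open>e\<close> bounds the number of vectors above, and counting real dimensions for
  the generating set formed by \<open>e\<close> and \<open>f\<close> bounds it below.\<close>

lemma card_I: "card I = CARD('n)"
proof (rule antisym)
  have "card (e ` I) \<le> vec.dim (UNIV :: (complex^'n) set)"
    using independent_e by (intro vec.independent_card_le_dim) auto
  then show "card I \<le> CARD('n)"
    by (simp add: card_image[OF inj_e] vec.dim_UNIV vec.dimension_def card_cart_basis)
  have "dim (UNIV :: (complex^'n) set) \<le> card (e ` I \<union> f ` I)"
    using spanning fin by (intro dim_le_card) auto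
  also have "\<dots> \<le> card (e ` I) + card (f ` I)" by (rule card_Un_le)
  also have "\<dots> \<le> card I + card I" using fin by (intro add_mono card_image_le)
  finally show "CARD('n) \<le> card I" by simp
qed

lemma cspan_e: "vec.span (e ` I) = UNIV"
proof -
  have "card (e ` I) = vec.dim (UNIV :: (complex^'n) set)"
    by (simp add: card_image[OF inj_e] vec.dim_UNIV vec.dimension_def card_cart_basis card_I)
  then show ?thesis
    using vec.card_ge_dim_independent[of "e ` I" UNIV] independent_e by auto
qed

end

section \<open>Lattices that become products in suitable coordinates\<close>

text \<open>Elementary divisors for multiplication by \<open>z\<close> yield bases \<open>e'\<close>, \<open>f'\<close> with
  \<open>f'\<^sub>i = (z / d\<^sub>i) e'\<^sub>i\<close>, so \<open>\<Lambda>\<close> is diagonal in the complex coordinates given by \<open>e'\<close>, with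
  the lattice \<open>\<int> + \<int> (z / d\<^sub>i)\<close> in the \<open>i\<close>-th coordinate.\<close>

lemma lattice_torus_isomorphic_product:
  fixes e f :: "'n \<Rightarrow> complex^'n"
  assumes gen: "vec.span (range e) = UNIV"
    and \<Lambda>: "\<Lambda> = {x + y | x y. x \<in> zmod.span (range e) \<and> y \<in> zmod.span (range f)}"
    and z: "Im z \<noteq> 0" and zL: "\<And>i. z *s e i \<in> zmod.span (range f)"
  shows "\<exists>E :: 'n \<Rightarrow> complex set. (\<forall>i. is_lattice (E i)) \<and> torus_isomorphic \<Lambda> (product_lattice E)"
proof -
  have "module_hom zscale zscale ((*s) z :: complex^'n \<Rightarrow> complex^'n)"
    by unfold_locales
      (simp_all add: zscale_def scaleR_conv_vector_smult vec.scale_right_distrib mult.commute)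
  from elementary_divisors[of UNIV "(*s) z" e f, OF finite this zL]
  obtain e' f' :: "'n \<Rightarrow> complex^'n" and d where e': "zmod.span (range e') = zmod.span (range e)"
    and f': "zmod.span (range f') = zmod.span (range f)"
    and d: "\<And>i. z *s e' i = zscale (d i) (f' i)" by blast
  define Q where "Q c = (\<Sum>i\<in>UNIV. c $ i *s e' i)" for c :: "complex^'n"
  have Q: "clinear Q"
    by unfold_locales
      (simp_all add: Q_def vec.scale_left_distrib vec.scale_right_distrib sum.distrib vec.scale_sum_right)
  interpret Q: Vector_Spaces.linear "(*s)" "(*s)" Q by (rule Q)
  have Q_axis: "Q (axis i 1) = e' i" for i
    by (simp add: Q_def axis_def if_distrib[of "\<lambda>c. c *s _"] cong: if_cong)
  have "surj Q"
  proof -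
    have sub: "vec.subspace (range Q)" by (rule Q.subspace_image) simp
    have "zmod.span (range e') \<subseteq> range Q"
    proof (rule zmod.span_minimal)
      show "range e' \<subseteq> range Q" using Q_axis by (metis image_subsetI rangeI)
      show "zmod.subspace (range Q)"
        using sub unfolding zmod.subspace_def vec.subspace_def zscale_def scaleR_conv_vector_smult by blast
    qed
    then have "range e \<subseteq> range Q" using zmod.span_superset[of "range e"] e' by blast
    then have "vec.span (range e) \<subseteq> range Q" using sub by (rule vec.span_minimal)
    then show ?thesis unfolding gen by (rule top.extremum_uniqueI)
  qed
  then obtain P where P: "clinear P" "\<And>x. P (Q x) = x" "\<And>x. Q (P x) = x"
    using vec.linear_surjective_isomorphism[OF Q] by auto
  have e'_nz: "e' i \<noteq> 0" for i
    using P(2)[of "axis i 1"] P(2)[of 0] unfolding Q_axis Q.zero by (metis axis_eq_0_iff zero_neq_one)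
  have d_nz: "d i \<noteq> 0" for i
    using d[of i] e'_nz[of i] z by auto
  have f'_eq: "f' i = (z / of_int (d i)) *s e' i" for i
  proof -
    have "(1 / of_int (d i)) *s (z *s e' i) = f' i"
      using d_nz[of i] unfolding d zscale_def scaleR_conv_vector_smult by simp
    then show ?thesis by simp
  qed
  define E where "E i = {of_int a + of_int b * (z / of_int (d i)) | a b. True}" for i
  have "Im (z / of_int (d i)) \<noteq> 0" for i
    using z d_nz[of i] by (simp add: Im_divide power2_eq_square)
  then have lat: "is_lattice (E i)" for i unfolding E_def by (rule is_lattice_nonreal)
  have "\<Lambda> = Q ` product_lattice E"
  proof (intro equalityI subsetI)
    fix v assume "v \<in> \<Lambda>"
    then obtain x y where v: "v = x + y" and x: "x \<in> zmod.span (range e')" and y: "y \<in> zmod.span (range f')"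
      unfolding \<Lambda> e' f' by blast
    obtain a where a: "x = (\<Sum>i\<in>UNIV. zscale (a i) (e' i))" using zspan_family[OF finite x] .
    obtain b where b: "y = (\<Sum>i\<in>UNIV. zscale (b i) (f' i))" using zspan_family[OF finite y] .
    let ?c = "\<chi> i. of_int (a i) + of_int (b i) * (z / of_int (d i))"
    have "v = Q ?c"
      by (simp add: v a b Q_def f'_eq zscale_def scaleR_conv_vector_smult vec.scale_left_distrib sum.distrib)
    moreover have "?c \<in> product_lattice E" by (auto simp: product_lattice_def E_def)
    ultimately show "v \<in> Q ` product_lattice E" by blast
  next
    fix v assume "v \<in> Q ` product_lattice E"
    then obtain c where c: "v = Q c" "\<And>i. c $ i \<in> E i" by (auto simp: product_lattice_def)
    then have "\<forall>i. \<exists>a b. c $ i = of_int a + of_int b * (z / of_int (d i))" by (auto simp: E_def)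
    then obtain a b where ab: "\<And>i. c $ i = of_int (a i) + of_int (b i) * (z / of_int (d i))" by metis
    have "v = (\<Sum>i\<in>UNIV. zscale (a i) (e' i)) + (\<Sum>i\<in>UNIV. zscale (b i) (f' i))"
      by (simp add: c(1) Q_def ab f'_eq zscale_def scaleR_conv_vector_smult vec.scale_left_distrib sum.distrib)
    moreover have "(\<Sum>i\<in>UNIV. zscale (a i) (e' i)) \<in> zmod.span (range e')"
      "(\<Sum>i\<in>UNIV. zscale (b i) (f' i)) \<in> zmod.span (range f')"
      by (intro zmod.span_sum zmod.span_scale zmod.span_base rangeI)+
    ultimately show "v \<in> \<Lambda>" unfolding \<Lambda> e' f' by blast
  qed
  then have "P ` \<Lambda> = product_lattice E" by (simp add: image_image P(2))
  then have "torus_isomorphic \<Lambda> (product_lattice E)"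
    using P(1) Q P(3,2) by (intro torus_isomorphic_clinear)
  with lat show ?thesis by blast
qed

section \<open>A scalar that maps one summand into the other\<close>

context symplectic_basis
begin

text \<open>The group acts on the two summands by mutually dual representations, and an invariant integral form
  \<open>b\<close> on the first is the same as an equivariant integral map \<open>S\<close> from the first to the second. Schur's
  lemma, a hypothesis here, turns the complex extension of \<open>S\<close> into a scalar.\<close>

lemma intertwiner_scalar:
  fixes G :: "('g, 'a) monoid_scheme" and A :: "'g \<Rightarrow> complex^'n \<Rightarrow> complex^'n"
  assumes G: "group G" "finite (carrier G)"
    and A: "\<And>g. g \<in> carrier G \<Longrightarrow> clinear (A g)"
    and A_H: "\<And>g x y. g \<in> carrier G \<Longrightarrow> H (A g x) (A g y) = H x y"
    and A_e: "\<And>g x. g \<in> carrier G \<Longrightarrow> x \<in> zmod.span (e ` I) \<Longrightarrow> A g x \<in> zmod.span (e ` I)"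
    and A_f: "\<And>g x. g \<in> carrier G \<Longrightarrow> x \<in> zmod.span (f ` I) \<Longrightarrow> A g x \<in> zmod.span (f ` I)"
    and A_mult: "\<And>g h x. g \<in> carrier G \<Longrightarrow> h \<in> carrier G \<Longrightarrow> x \<in> zmod.span (e ` I) \<Longrightarrow>
      A (g \<otimes>\<^bsub>G\<^esub> h) x = A g (A h x)"
    and A_one: "\<And>x. x \<in> zmod.span (e ` I) \<Longrightarrow> A \<one>\<^bsub>G\<^esub> x = x"
    and schur: "\<And>T. clinear T \<Longrightarrow> (\<And>g v. g \<in> carrier G \<Longrightarrow> T (A g v) = A g (T v)) \<Longrightarrow>
      \<exists>z. \<forall>v. T v = z *s v"
  shows "\<exists>z. Im z \<noteq> 0 \<and> (\<forall>i\<in>I. z *s e i \<in> zmod.span (f ` I))"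
proof -
  interpret G: group G by (rule G)
  let ?L1 = "zmod.span (e ` I)" and ?L2 = "zmod.span (f ` I)"
  have A_linear: "linear (A g)" if "g \<in> carrier G" for g
    using A[OF that] by (rule clinear_linear)
  have A_E: "E (A g x) (A g y) = E x y" if "g \<in> carrier G" for g x y
    using A_H[OF that] by (simp add: E_def)
  have e_L1: "e i \<in> ?L1" if "i \<in> I" for i using that by (intro zmod.span_base) auto

  \<comment> \<open>The functional \<open>\<lambda>x. E x (f i)\<close> is the \<open>i\<close>-th coordinate on \<open>L\<^sub>1\<close>, so \<open>b\<close> is the sum over \<open>G\<close> of
    the translates of the standard inner product for the basis \<open>e\<close>. Without division by the order of
    \<open>G\<close> it remains integral.\<close>
  define b where "b x y = (\<Sum>g\<in>carrier G. \<Sum>i\<in>I. E (A g x) (f i) * E (A g y) (f i))" for x y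
  have b_lin_left: "linear (\<lambda>x. b x y)" for y
    unfolding b_def
    by (intro linear_compose_sum ballI linear_compose[OF A_linear, unfolded o_def, of _ "\<lambda>x. E x _ * _"] linearI)
      (simp_all add: E_add_left E_scaleR_left algebra_simps)
  have b_sym: "b x y = b y x" for x y by (simp add: b_def mult.commute)
  have b_lin_right: "linear (b x)" for x
    using b_lin_left[of x] by (simp add: b_sym[of _ x])
  have b_inv: "b (A h x) (A h y) = b x y" if h: "h \<in> carrier G" and x: "x \<in> ?L1" and y: "y \<in> ?L1" for h x y
    unfolding b_def
    by (rule sum.reindex_bij_witness[of _ "\<lambda>g. g \<otimes>\<^bsub>G\<^esub> inv\<^bsub>G\<^esub> h" "\<lambda>g. g \<otimes>\<^bsub>G\<^esub> h"])
      (use h x y in \<open>auto simp: A_mult G.m_assoc\<close>)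
  have b_int: "b x y \<in> \<int>" if "x \<in> ?L1" "y \<in> ?L1" for x y
    unfolding b_def using that by (intro Ints_sum Ints_mult zspan_e_coord(2) A_e)
  have b_pos: "0 < b (e i) (e i)" if i: "i \<in> I" for i
  proof -
    have "1 = E (A \<one>\<^bsub>G\<^esub> (e i)) (f i) * E (A \<one>\<^bsub>G\<^esub> (e i)) (f i)"
      using i by (simp add: A_one e_L1 E_ef)
    also have "\<dots> \<le> (\<Sum>j\<in>I. E (A \<one>\<^bsub>G\<^esub> (e i)) (f j) * E (A \<one>\<^bsub>G\<^esub> (e i)) (f j))"
      using i fin by (intro member_le_sum) auto
    also have "\<dots> \<le> b (e i) (e i)"
      unfolding b_def using G(2)
      by (intro member_le_sum[where f = "\<lambda>g. \<Sum>j\<in>I. E (A g (e i)) (f j) * E (A g (e i)) (f j)"] sum_nonneg) auto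
    finally show ?thesis by simp
  qed

  \<comment> \<open>By duality of \<open>e\<close> and \<open>f\<close>, these coefficients are the only ones with \<open>E x (S y) = b x y\<close> on
    \<open>L\<^sub>1\<close>.\<close>
  define S where "S y = (\<Sum>k\<in>I. b (e k) y *\<^sub>R f k)" for y
  have S_lin: "linear S"
    unfolding S_def by (intro linear_compose_sum ballI linearI)
      (simp_all add: linear_add[OF b_lin_right] linear_scale[OF b_lin_right] scaleR_left_distrib)
  have S_L2: "S y \<in> ?L2" if y: "y \<in> ?L1" for y
    unfolding S_def
  proof (intro zmod.span_sum)
    fix k assume k: "k \<in> I"
    then obtain m where "b (e k) y = of_int m" using b_int[OF e_L1[OF k] y] by (auto elim: Ints_cases)
    then have "b (e k) y *\<^sub>R f k = zscale m (f k)" by (simp add: zscale_def)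
    then show "b (e k) y *\<^sub>R f k \<in> ?L2"
      using k by (auto intro: zmod.span_scale zmod.span_base)
  qed
  have E_S: "E x (S y) = b x y" if x: "x \<in> ?L1" for x y
  proof -
    have "E x (S y) = (\<Sum>k\<in>I. E x (f k) * b (e k) y)"
      by (simp add: S_def E_sum_right E_scaleR_right mult.commute)
    also have "\<dots> = b (\<Sum>k\<in>I. E x (f k) *\<^sub>R e k) y"
      by (simp add: linear_sum[OF b_lin_left] linear_scale[OF b_lin_left])
    finally show ?thesis using zspan_e_coord(1)[OF x] by simp
  qed
  have L2_eqI: "u = v" if u: "u \<in> ?L2" and v: "v \<in> ?L2" and uv: "\<And>x. x \<in> ?L1 \<Longrightarrow> E x u = E x v" for u v
    using zspan_f_coord[OF u] zspan_f_coord[OF v] uv[OF e_L1] by simp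
  have S_equiv: "S (A g y) = A g (S y)" if g: "g \<in> carrier G" and y: "y \<in> ?L1" for g y
  proof (rule L2_eqI)
    show "S (A g y) \<in> ?L2" "A g (S y) \<in> ?L2" using g y by (auto intro: S_L2 A_e A_f)
    fix x assume x: "x \<in> ?L1"
    define x' where "x' = A (inv\<^bsub>G\<^esub> g) x"
    have x': "x' \<in> ?L1" "x = A g x'"
      using g x by (auto simp: x'_def A_e A_one simp flip: A_mult)
    then have "E x (A g (S y)) = b x' y" using g by (simp add: A_E E_S)
    also have "\<dots> = b x (A g y)" unfolding x'(2) using b_inv[OF g x'(1) y] by simp
    also have "\<dots> = E x (S (A g y))" using x by (simp add: E_S)
    finally show "E x (S (A g y)) = E x (A g (S y))" by simp
  qed

  obtain T where T: "clinear T" and T_e: "\<And>x. x \<in> e ` I \<Longrightarrow> T x = S x"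
    using vec.linear_independent_extend[OF independent_e, of S] by blast
  have T_S: "T y = S y" if "y \<in> ?L1" for y
  proof -
    have "T (\<Sum>i\<in>I. E y (f i) *\<^sub>R e i) = S (\<Sum>i\<in>I. E y (f i) *\<^sub>R e i)"
      by (simp add: linear_sum[OF S_lin] linear_scale[OF S_lin] linear_sum[OF clinear_linear[OF T]]
          linear_scale[OF clinear_linear[OF T]] T_e)
    then show ?thesis using zspan_e_coord(1)[OF that] by simp
  qed
  have "T (A g v) = A g (T v)" if g: "g \<in> carrier G" for g v
  proof -
    have "(T \<circ> A g) v = (A g \<circ> T) v"
    proof (rule vec.linear_eq_on_span[of "T \<circ> A g" "A g \<circ> T" "e ` I" v])
      show "clinear (T \<circ> A g)" using A[OF g] T by (rule Vector_Spaces.linear_compose)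
      show "clinear (A g \<circ> T)" using T A[OF g] by (rule Vector_Spaces.linear_compose)
      show "(T \<circ> A g) x = (A g \<circ> T) x" if "x \<in> e ` I" for x
        using that g by (auto simp: T_S S_equiv A_e e_L1)
      show "v \<in> vec.span (e ` I)" by (simp add: cspan_e)
    qed
    then show ?thesis by simp
  qed
  from schur[OF T this] obtain z where z: "\<And>v. T v = z *s v" by blast
  have zS: "z *s e i = S (e i)" if "i \<in> I" for i
    using z[of "e i"] T_e that by simp
  have "I \<noteq> {}" using card_I by auto
  then obtain i where i: "i \<in> I" by blast
  have "E (e i) (z *s e i) \<noteq> 0" using b_pos[OF i] i by (simp add: zS E_S e_L1)
  then have "Im z \<noteq> 0" by (auto simp: E_scale_self)
  moreover have "\<forall>i\<in>I. z *s e i \<in> ?L2" using zS S_L2 e_L1 by simp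
  ultimately show ?thesis by blast
qed

end

section \<open>Dual bases of a Lagrangian splitting\<close>

lemma free_Abelian_group_basis:
  fixes L :: "'v::real_vector set"
  assumes iso: "free_Abelian_group {..<r::nat} \<cong> add_group \<lparr>carrier := L\<rparr>"
  obtains e :: "nat \<Rightarrow> 'v" and \<phi> :: "nat \<Rightarrow> 'v \<Rightarrow> int"
  where "\<And>i. i < r \<Longrightarrow> e i \<in> L"
    and "\<And>x. x \<in> L \<Longrightarrow> x = (\<Sum>i<r. zscale (\<phi> i x) (e i))"
    and "\<And>i x y. x \<in> L \<Longrightarrow> y \<in> L \<Longrightarrow> \<phi> i (x + y) = \<phi> i x + \<phi> i y"
    and "\<And>i j. i < r \<Longrightarrow> j < r \<Longrightarrow> \<phi> i (e j) = (if i = j then 1 else 0)"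
proof -
  let ?F = "free_Abelian_group {..<r}"
  obtain k where k: "k \<in> iso ?F (add_group \<lparr>carrier := L\<rparr>)"
    using iso by (auto simp: is_iso_def)
  have k_bij: "bij_betw k (carrier ?F) L" using k by (simp add: iso_def add_group_def)
  have k_surj: "\<exists>c\<in>carrier ?F. x = k c" if "x \<in> L" for x
  proof -
    have "x \<in> k ` carrier ?F" using that bij_betw_imp_surj_on[OF k_bij] by blast
    then show ?thesis by blast
  qed
  have k_add: "k (x + y) = k x + k y" if "x \<in> carrier ?F" "y \<in> carrier ?F" for x y
    using k that by (auto simp: iso_def hom_def add_group_def simp del: carrier_free_Abelian_group_iff)
  have F_add: "x + y \<in> carrier ?F" if "x \<in> carrier ?F" "y \<in> carrier ?F" for x y
    using that Poly_Mapping.keys_add[of x y] by auto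
  have F_diff: "x - y \<in> carrier ?F" if "x \<in> carrier ?F" "y \<in> carrier ?F" for x y
    using that keys_diff[of x y] by auto
  have k_diff: "k (x - y) = k x - k y" if "x \<in> carrier ?F" "y \<in> carrier ?F" for x y
    using k_add[OF F_diff[OF that] that(2)] by (simp add: algebra_simps)
  have k_0: "k 0 = 0" using k_diff[of 0 0] by simp
  define e where "e i = k (frag_of i)" for i
  define \<phi> where "\<phi> i x = Poly_Mapping.lookup (inv_into (carrier ?F) k x) i" for i x
  have inv_k: "inv_into (carrier ?F) k (k c) = c" if "c \<in> carrier ?F" for c
    using k_bij that by (simp add: bij_betw_def inv_into_f_f del: carrier_free_Abelian_group_iff)
  have k_expand: "k c = (\<Sum>i<r. zscale (Poly_Mapping.lookup c i) (e i))"
    if "Poly_Mapping.keys c \<subseteq> {..<r}" for c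
  proof (rule free_Abelian_group_induct[OF that,
        where P = "\<lambda>c. k c = (\<Sum>i<r. zscale (Poly_Mapping.lookup c i) (e i))"])
    show "k 0 = (\<Sum>i<r. zscale (Poly_Mapping.lookup 0 i) (e i))" by (simp add: k_0)
  next
    fix x y
    assume "Poly_Mapping.keys x \<subseteq> {..<r}" "Poly_Mapping.keys y \<subseteq> {..<r}"
      and "k x = (\<Sum>i<r. zscale (Poly_Mapping.lookup x i) (e i))"
      and "k y = (\<Sum>i<r. zscale (Poly_Mapping.lookup y i) (e i))"
    then show "k (x - y) = (\<Sum>i<r. zscale (Poly_Mapping.lookup (x - y) i) (e i))"
      by (simp add: k_diff lookup_minus zmod.scale_left_diff_distrib sum_subtractf)
  next
    fix i assume "i \<in> {..<r}"
    moreover have "(\<Sum>j<r. zscale (Poly_Mapping.lookup (frag_of i) j) (e j)) = (\<Sum>j<r. if j = i then e j else 0)"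
      by (intro sum.cong) auto
    ultimately show "k (frag_of i) = (\<Sum>j<r. zscale (Poly_Mapping.lookup (frag_of i) j) (e j))"
      by (simp add: e_def)
  qed
  show thesis
  proof (rule that[of e \<phi>])
    show "e i \<in> L" if "i < r" for i
      using bij_betwE[OF k_bij, rule_format, of "frag_of i"] that by (simp add: e_def)
    show "x = (\<Sum>i<r. zscale (\<phi> i x) (e i))" if x: "x \<in> L" for x
    proof -
      obtain c where c: "c \<in> carrier ?F" "x = k c"
        using k_surj[OF x] by blast
      have "\<phi> i x = Poly_Mapping.lookup c i" for i using c by (simp only: \<phi>_def inv_k)
      then show ?thesis using k_expand[of c] c by (simp only: carrier_free_Abelian_group_iff)
    qed
    show "\<phi> i (x + y) = \<phi> i x + \<phi> i y" if xy: "x \<in> L" "y \<in> L" for i x y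
    proof -
      obtain c d where cd: "c \<in> carrier ?F" "x = k c" "d \<in> carrier ?F" "y = k d"
        using k_surj[OF xy(1)] k_surj[OF xy(2)] by blast
      then have "x + y = k (c + d)" using k_add by simp
      then show ?thesis using inv_k[OF F_add[OF cd(1,3)]] inv_k[OF cd(1)] inv_k[OF cd(3)]
        by (simp add: \<phi>_def cd(2,4) lookup_add)
    qed
    show "\<phi> i (e j) = (if i = j then 1 else 0)" if "i < r" "j < r" for i j
      using inv_k[of "frag_of j"] that by (simp add: \<phi>_def e_def)
  qed
qed

lemma lattice_zero: "is_lattice \<Lambda> \<Longrightarrow> 0 \<in> \<Lambda>"
  unfolding is_lattice_def by (auto intro!: range_eqI[of _ _ "\<lambda>_. 0"])

lemma ppav_nondegenerate:
  assumes ppav: "ppav \<Lambda> H" and y: "y \<in> \<Lambda>" and orth: "\<And>x. x \<in> \<Lambda> \<Longrightarrow> Im (H x y) = 0"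
  shows "y = 0"
proof -
  interpret hermitian_form H using ppav by unfold_locales (simp add: ppav_def)
  have "unimodular_on \<Lambda> (\<lambda>x y. Im (H x y))" using ppav by (simp add: ppav_def)
  from this[unfolded unimodular_on_def, rule_format, of "\<lambda>_. 0"]
  have "\<exists>!y. y \<in> \<Lambda> \<and> (\<forall>x\<in>\<Lambda>. Im (H x y) = 0)" by simp
  moreover have "Im (H x 0) = 0" for x using E_zero_right by (simp add: E_def)
  ultimately show ?thesis using y orth lattice_zero[of \<Lambda>] ppav by (auto simp: ppav_def)
qed

text \<open>Take a \<open>\<int>\<close>-basis \<open>e\<close> of \<open>L\<^sub>1\<close> and extend each coordinate functional by \<open>0\<close> on \<open>L\<^sub>2\<close>. By unimodularity
  the extension is \<open>\<lambda>x. E x w\<close> for some \<open>w\<close> in \<open>\<Lambda>\<close>. The \<open>L\<^sub>1\<close>-component of \<open>w\<close> is \<open>E\<close>-orthogonal to \<open>L\<^sub>2\<close> by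
  the choice of the extension and to \<open>L\<^sub>1\<close> by isotropy, hence \<open>0\<close>. So \<open>w\<close> lies in \<open>L\<^sub>2\<close>, and these elements form the
  dual basis \<open>f\<close>: an element of \<open>L\<^sub>2\<close> is determined by its pairings with \<open>e\<close>.\<close>
lemma symplectic_basis_of_splitting:
  fixes \<Lambda> :: "(complex^'n) set" and L\<^sub>1 L\<^sub>2 :: "(complex^'n) set"
  assumes ppav: "ppav \<Lambda> H"
    and L1: "subgroup L\<^sub>1 add_group" and L2: "subgroup L\<^sub>2 add_group"
    and \<Lambda>: "\<Lambda> = {x + y | x y. x \<in> L\<^sub>1 \<and> y \<in> L\<^sub>2}" and disj: "L\<^sub>1 \<inter> L\<^sub>2 = {0}"
    and iso1: "\<forall>x\<in>L\<^sub>1. \<forall>y\<in>L\<^sub>1. Im (H x y) = 0" and iso2: "\<forall>x\<in>L\<^sub>2. \<forall>y\<in>L\<^sub>2. Im (H x y) = 0"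
    and free: "free_Abelian_group {..<r::nat} \<cong> add_group \<lparr>carrier := L\<^sub>1\<rparr>"
  shows "\<exists>e f :: 'n \<Rightarrow> complex^'n. symplectic_basis H UNIV e f \<and>
    L\<^sub>1 = zmod.span (range e) \<and> L\<^sub>2 = zmod.span (range f)"
proof -
  interpret hermitian_form H using ppav by unfold_locales (simp add: ppav_def)
  have sub: "zmod.subspace L" if sg: "subgroup L add_group" for L :: "(complex^'n) set"
  proof -
    have 0: "0 \<in> L" and add: "\<And>x y. x \<in> L \<Longrightarrow> y \<in> L \<Longrightarrow> x + y \<in> L"
      using subgroup.one_closed[OF sg] subgroup.m_closed[OF sg] by (auto simp: add_group_def)
    have grp: "group (add_group :: (complex^'n) monoid)"
      by (rule groupI) (auto simp: add_group_def add.assoc intro: exI[of _ "- _"])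
    have neg_closed: "- x \<in> L" if x: "x \<in> L" for x
    proof -
      have "inv\<^bsub>add_group\<^esub> x = - x"
        by (rule group.inv_equality[OF grp]) (auto simp: add_group_def)
      then show ?thesis using subgroup.m_inv_closed[OF sg x] by simp
    qed
    have nat: "zscale (int n) x \<in> L" if "x \<in> L" for n x
      by (induction n) (use that 0 add in \<open>auto simp: zmod.scale_left_distrib\<close>)
    have "zscale k x \<in> L" if "x \<in> L" for k x
    proof (cases k)
      case (neg n)
      then have "zscale k x = - zscale (int (Suc n)) x" by (simp only: zmod.scale_minus_left)
      then show ?thesis using neg_closed[OF nat[OF that, of "Suc n"]] by (simp only:)
    qed (use nat that in auto)
    with 0 add show ?thesis by (intro zmod.subspaceI)
  qed
  note sub1 = sub[OF L1] and sub2 = sub[OF L2]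
  have 0: "0 \<in> L\<^sub>1" "0 \<in> L\<^sub>2" using zmod.subspace_0 sub1 sub2 by auto
  have L1_sub: "L\<^sub>1 \<subseteq> \<Lambda>" and L2_sub: "L\<^sub>2 \<subseteq> \<Lambda>" unfolding \<Lambda> using 0 by force+
  have E11: "E x y = 0" if "x \<in> L\<^sub>1" "y \<in> L\<^sub>1" for x y using iso1 that by (simp add: E_def)
  have E22: "E x y = 0" if "x \<in> L\<^sub>2" "y \<in> L\<^sub>2" for x y using iso2 that by (simp add: E_def)
  have unimod: "\<exists>!y. y \<in> \<Lambda> \<and> (\<forall>x\<in>\<Lambda>. E x y = of_int (h x))"
    if "\<forall>x\<in>\<Lambda>. \<forall>y\<in>\<Lambda>. h (x + y) = h x + h y" for h :: "complex^'n \<Rightarrow> int"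
    using ppav that by (simp add: ppav_def unimodular_on_def E_def)
  have nondeg: "y = 0" if "y \<in> \<Lambda>" "\<And>x. x \<in> \<Lambda> \<Longrightarrow> E x y = 0" for y
    using ppav_nondegenerate[OF ppav that(1)] that(2) by (simp add: E_def)

  obtain e \<phi> where e: "\<And>i. i < r \<Longrightarrow> e i \<in> L\<^sub>1"
    and \<phi>: "\<And>x. x \<in> L\<^sub>1 \<Longrightarrow> x = (\<Sum>i<r. zscale (\<phi> i x) (e i))"
    and \<phi>_add: "\<And>i x y. x \<in> L\<^sub>1 \<Longrightarrow> y \<in> L\<^sub>1 \<Longrightarrow> \<phi> i (x + y) = \<phi> i x + \<phi> i y"
    and \<phi>_e: "\<And>i j. i < r \<Longrightarrow> j < r \<Longrightarrow> \<phi> i (e j) = (if i = j then 1 else 0)"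
    by (rule free_Abelian_group_basis[OF free]) blast

  \<comment> \<open>the projection of \<open>\<Lambda>\<close> to \<open>L\<^sub>1\<close> along \<open>L\<^sub>2\<close>\<close>
  define p where "p v = (THE x. x \<in> L\<^sub>1 \<and> v - x \<in> L\<^sub>2)" for v
  have p: "p (x + y) = x" if "x \<in> L\<^sub>1" "y \<in> L\<^sub>2" for x y
    unfolding p_def
  proof (rule the_equality)
    fix x' assume x': "x' \<in> L\<^sub>1 \<and> x + y - x' \<in> L\<^sub>2"
    have "x + y - x' - y \<in> L\<^sub>2" using x' that(2) zmod.subspace_diff[OF sub2] by blast
    then have "x - x' \<in> L\<^sub>1 \<inter> L\<^sub>2" using x' that(1) zmod.subspace_diff[OF sub1] by (simp add: algebra_simps)
    then show "x' = x" using disj by auto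
  qed (use that in auto)
  have p_add: "p (v + w) = p v + p w" and p_L1: "p v \<in> L\<^sub>1" if vw: "v \<in> \<Lambda>" "w \<in> \<Lambda>" for v w
  proof -
    obtain x y x' y' where "x \<in> L\<^sub>1" "y \<in> L\<^sub>2" "v = x + y" "x' \<in> L\<^sub>1" "y' \<in> L\<^sub>2" "w = x' + y'"
      using vw unfolding \<Lambda> by blast
    moreover from this have "p ((x + x') + (y + y')) = x + x'"
      by (intro p zmod.subspace_add[OF sub1] zmod.subspace_add[OF sub2])
    ultimately show "p (v + w) = p v + p w" "p v \<in> L\<^sub>1" by (simp_all add: p algebra_simps)
  qed
  have "\<exists>y. y \<in> L\<^sub>2 \<and> (\<forall>x\<in>L\<^sub>1. E x y = of_int (\<phi> i x))" for i
  proof -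
    have "\<forall>x\<in>\<Lambda>. \<forall>y\<in>\<Lambda>. \<phi> i (p (x + y)) = \<phi> i (p x) + \<phi> i (p y)"
      by (simp add: p_add p_L1 \<phi>_add)
    from unimod[OF this] obtain w where w: "w \<in> \<Lambda>" "\<And>x. x \<in> \<Lambda> \<Longrightarrow> E x w = of_int (\<phi> i (p x))"
      by blast
    obtain x y where xy: "x \<in> L\<^sub>1" "y \<in> L\<^sub>2" "w = x + y" using w(1) unfolding \<Lambda> by blast
    have \<phi>0: "\<phi> i 0 = 0" using \<phi>_add[of 0 0 i] 0 by simp
    have "x = 0"
    proof (rule nondeg)
      show "x \<in> \<Lambda>" using xy(1) L1_sub by blast
      fix u assume "u \<in> \<Lambda>"
      then obtain u1 u2 where u: "u1 \<in> L\<^sub>1" "u2 \<in> L\<^sub>2" "u = u1 + u2" unfolding \<Lambda> by blast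
      have "E u2 w = 0" using w(2)[of u2] p[of 0 u2] 0 u(2) L2_sub \<phi>0 by auto
      then have "E u2 x = 0" using E22[OF u(2) xy(2)] by (simp add: xy(3) E_add_right)
      then show "E u x = 0" using E11[OF u(1) xy(1)] by (simp add: u(3) E_add_left)
    qed
    then have "w \<in> L\<^sub>2" using xy by simp
    moreover have "E v w = of_int (\<phi> i v)" if "v \<in> L\<^sub>1" for v
      using w(2)[of v] p[of v 0] 0 that L1_sub by auto
    ultimately show ?thesis by blast
  qed
  then obtain f where f: "\<And>i. f i \<in> L\<^sub>2" and E_f: "\<And>i x. x \<in> L\<^sub>1 \<Longrightarrow> E x (f i) = of_int (\<phi> i x)" by metis

  have L1_eq: "L\<^sub>1 = zmod.span (e ` {..<r})"
  proof
    show "zmod.span (e ` {..<r}) \<subseteq> L\<^sub>1" using e sub1 by (intro zmod.span_minimal) auto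
    show "L\<^sub>1 \<subseteq> zmod.span (e ` {..<r})"
    proof
      fix x assume "x \<in> L\<^sub>1"
      from \<phi>[OF this] show "x \<in> zmod.span (e ` {..<r})"
        by (rule ssubst) (intro zmod.span_sum zmod.span_scale zmod.span_base imageI)
    qed
  qed
  have E_int: "E x y \<in> \<int>" if "x \<in> \<Lambda>" "y \<in> \<Lambda>" for x y
    using ppav that by (simp add: ppav_def E_def)
  have L2_eq: "L\<^sub>2 = zmod.span (f ` {..<r})"
  proof
    show "zmod.span (f ` {..<r}) \<subseteq> L\<^sub>2" using f sub2 by (intro zmod.span_minimal) auto
    show "L\<^sub>2 \<subseteq> zmod.span (f ` {..<r})"
    proof
      fix y assume y: "y \<in> L\<^sub>2"
      define y' where "y' = (\<Sum>i<r. zscale \<lfloor>E (e i) y\<rfloor> (f i))"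
      have y': "y' \<in> zmod.span (f ` {..<r})"
        unfolding y'_def by (intro zmod.span_sum zmod.span_scale zmod.span_base imageI)
      then have y'2: "y' \<in> L\<^sub>2" using f sub2 zmod.span_minimal[of "f ` {..<r}" L\<^sub>2] by blast
      have ee: "E (e j) y' = E (e j) y" if j: "j < r" for j
      proof -
        have "E (e j) y' = of_int \<lfloor>E (e j) y\<rfloor>"
          using j by (simp add: y'_def zscale_def E_sum_right E_scaleR_right E_f e \<phi>_e if_distrib cong: if_cong)
        also have "\<dots> = E (e j) y" using E_int[of "e j" y] e[OF j] y L1_sub L2_sub by (auto elim: Ints_cases)
        finally show ?thesis .
      qed
      have "y - y' = 0"
      proof (rule nondeg)
        show "y - y' \<in> \<Lambda>" using zmod.subspace_diff[OF sub2 y y'2] L2_sub by blast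
        fix u assume "u \<in> \<Lambda>"
        then obtain u1 u2 where u: "u1 \<in> L\<^sub>1" "u2 \<in> L\<^sub>2" "u = u1 + u2" unfolding \<Lambda> by blast
        have "E u1 (y - y') = (\<Sum>i<r. of_int (\<phi> i u1) * E (e i) (y - y'))"
          by (subst \<phi>[OF u(1)]) (simp add: zscale_def E_sum_left E_scaleR_left)
        also have "\<dots> = 0" using ee by (simp add: E_diff_right)
        finally show "E u (y - y') = 0"
          using E22[OF u(2) zmod.subspace_diff[OF sub2 y y'2]] by (simp add: u(3) E_add_left)
      qed
      with y' show "y \<in> zmod.span (f ` {..<r})" by simp
    qed
  qed
  have zspan_sub: "zmod.span X \<subseteq> span X" for X :: "(complex^'n) set"
    by (intro zmod.span_minimal) (auto simp: zmod.subspace_def zscale_def span_base span_zero span_add span_scale)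
  have "span (e ` {..<r} \<union> f ` {..<r}) = UNIV" (is "span ?S = _")
  proof -
    obtain B where B: "span B = UNIV" "independent B" "\<Lambda> = range (\<lambda>c :: complex^'n \<Rightarrow> int. \<Sum>b\<in>B. of_int (c b) *\<^sub>R b)"
      using ppav unfolding ppav_def is_lattice_def by blast
    have "B \<subseteq> \<Lambda>"
    proof
      fix b assume b: "b \<in> B"
      have "b = (\<Sum>x\<in>B. if x = b then x else 0)"
        using b by (simp add: finiteI_independent[OF B(2)])
      also have "\<dots> = (\<Sum>x\<in>B. of_int (if x = b then 1 else 0) *\<^sub>R x)" by (intro sum.cong) auto
      finally show "b \<in> \<Lambda>" unfolding B(3) by (rule range_eqI[of _ _ "\<lambda>x. if x = b then 1 else 0"])
    qed
    also have "\<Lambda> \<subseteq> span ?S"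
    proof
      fix v assume "v \<in> \<Lambda>"
      then obtain x y where "x \<in> zmod.span (e ` {..<r})" "y \<in> zmod.span (f ` {..<r})" "v = x + y"
        unfolding \<Lambda> L1_eq L2_eq by blast
      then have "x \<in> span (e ` {..<r})" "y \<in> span (f ` {..<r})" "v = x + y"
        using zspan_sub by blast+
      then show "v \<in> span ?S"
        using span_mono[of "e ` {..<r}" ?S] span_mono[of "f ` {..<r}" ?S] by (auto intro!: span_add)
    qed
    finally have "span B \<subseteq> span ?S" by (intro span_minimal subspace_span)
    then show ?thesis using B(1) by auto
  qed
  then interpret sb: symplectic_basis H "{..<r}" e f
    by unfold_locales (auto simp: E11 E22 e f E_f \<phi>_e)
  have "\<exists>h. bij_betw h (UNIV :: 'n set) {..<r}"
    by (rule finite_same_card_bij) (use sb.card_I in simp_all)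
  then obtain h where h: "bij_betw h (UNIV :: 'n set) {..<r}" by blast
  have im: "(g \<circ> h) ` UNIV = g ` {..<r}" for g :: "nat \<Rightarrow> complex^'n"
    unfolding image_comp[symmetric] bij_betw_imp_surj_on[OF h] ..
  have hr: "h i < r" for i using bij_betwE[OF h] by auto
  have h_eq: "h i = h j \<longleftrightarrow> i = j" for i j using h by (auto simp: bij_betw_def inj_on_def)
  have "symplectic_basis H UNIV (e \<circ> h) (f \<circ> h)"
    by unfold_locales (use sb.E_ee sb.E_ff sb.E_ef sb.spanning hr in \<open>simp_all add: im[unfolded o_def] h_eq\<close>)
  moreover have "L\<^sub>1 = zmod.span (range (e \<circ> h))" "L\<^sub>2 = zmod.span (range (f \<circ> h))"
    unfolding im using L1_eq L2_eq by simp_all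
  ultimately show ?thesis by blast
qed

section \<open>The product decomposition\<close>

text \<open>The lifts \<open>A g\<close> that occur in a \<open>\<rho>\<close>-decomposition are thereby the ones that preserve \<open>H\<close>. For a
  vector \<open>v\<close>, all real multiples of the difference \<open>D = A v - B v\<close> lie in \<open>\<Lambda>\<close>, so all real multiples of
  \<open>E x D\<close> with \<open>x\<close> in \<open>\<Lambda>\<close> are integers; therefore \<open>E x D = 0\<close> and \<open>D = 0\<close>.\<close>

lemma linear_lift_unique:
  assumes ppav: "ppav \<Lambda> H" and A: "linear_lift \<Lambda> \<phi> A" and B: "linear_lift \<Lambda> \<phi> B"
  shows "A = B"
proof
  fix v
  interpret hermitian_form H using ppav by unfold_locales (simp add: ppav_def)
  interpret A: Vector_Spaces.linear "(*s)" "(*s)" A using A by (simp add: linear_lift_def)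
  interpret B: Vector_Spaces.linear "(*s)" "(*s)" B using B by (simp add: linear_lift_def)
  define D where "D = A v - B v"
  have 0: "0 \<in> \<Lambda>" using ppav by (simp add: ppav_def lattice_zero)
  have mem: "t *\<^sub>R D \<in> \<Lambda>" for t
  proof -
    have "torus_proj \<Lambda> (A (t *\<^sub>R v)) = torus_proj \<Lambda> (B (t *\<^sub>R v))"
      using A B unfolding linear_lift_def by metis
    then have "0 + A (t *\<^sub>R v) \<in> torus_proj \<Lambda> (B (t *\<^sub>R v))"
      using 0 by (metis torus_proj_eq imageI)
    then have "A (t *\<^sub>R v) - B (t *\<^sub>R v) \<in> \<Lambda>" by (auto simp: torus_proj_eq)
    then show ?thesis
      by (simp add: D_def scaleR_conv_vector_smult A.scale B.scale vec.scale_right_diff_distrib)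
  qed
  have "E x D = 0" if x: "x \<in> \<Lambda>" for x
  proof (rule ccontr)
    assume nz: "E x D \<noteq> 0"
    have "E x ((1 / (2 * E x D)) *\<^sub>R D) \<in> \<int>"
      using ppav x mem by (simp add: ppav_def E_def)
    then have "(1 / 2 :: real) \<in> \<int>" using nz by (simp add: E_scaleR_right)
    then obtain k :: int where "1 / 2 = real_of_int k" by (auto elim: Ints_cases)
    then have "1 = 2 * k" by linarith
    then show False by presburger
  qed
  then have "D = 0" using mem[of 1] by (intro ppav_nondegenerate[OF ppav]) (auto simp: E_def)
  then show "A v = B v" by (simp add: D_def)
qed

theorem corollary2p8:
  fixes G :: "('g, 'a) monoid_scheme" and M :: "('m, 'b) monoid_scheme"
    and \<rho> :: "'g \<Rightarrow> 'm \<Rightarrow> 'm"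
    and \<Lambda> :: "(complex^'n) set" and H :: "complex^'n \<Rightarrow> complex^'n \<Rightarrow> complex"
  assumes "group G" and "finite (carrier G)"
    and "integral_rep G M \<rho>" and "faithful_rep G \<rho>" and "absolutely_irreducible G M \<rho>"
    and "ppav \<Lambda> H" and "rho_decomposable G M \<rho> \<Lambda> H"
  shows "\<exists>E :: 'n \<Rightarrow> complex set. (\<forall>i. is_lattice (E i)) \<and> torus_isomorphic \<Lambda> (product_lattice E)"
proof -
  interpret M: comm_group M using assms(3) by (simp add: integral_rep_def)
  obtain r :: nat where r: "M \<cong> free_Abelian_group {..<r}" and \<rho>_hom: "\<rho> \<in> hom G (AutoGroup M)"
    using assms(3) by (auto simp: integral_rep_def)
  obtain \<alpha> A L\<^sub>1 L\<^sub>2 where \<alpha>: "ppav_action G \<Lambda> H \<alpha>"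
    and lift: "\<forall>g\<in>carrier G. linear_lift \<Lambda> (\<alpha> g) (A g)"
    and L: "subgroup L\<^sub>1 add_group" "subgroup L\<^sub>2 add_group"
      "\<Lambda> = {x + y | x y. x \<in> L\<^sub>1 \<and> y \<in> L\<^sub>2}" "L\<^sub>1 \<inter> L\<^sub>2 = {0}"
    and A_L: "\<forall>g\<in>carrier G. A g ` L\<^sub>1 \<subseteq> L\<^sub>1 \<and> A g ` L\<^sub>2 \<subseteq> L\<^sub>2"
    and isotropic: "\<forall>x\<in>L\<^sub>1. \<forall>y\<in>L\<^sub>1. Im (H x y) = 0" "\<forall>x\<in>L\<^sub>2. \<forall>y\<in>L\<^sub>2. Im (H x y) = 0"
    and ZG: "ZG_isomorphic G M \<rho> (add_group \<lparr>carrier := L\<^sub>1\<rparr>) A"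
    using assms(7) unfolding rho_decomposable_def by (elim exE conjE) (rule that; assumption)
  note lift = lift[rule_format] and A_L = bspec[OF A_L]
  obtain \<theta> where \<theta>: "\<theta> \<in> iso M (add_group \<lparr>carrier := L\<^sub>1\<rparr>)"
    and \<theta>_equiv: "\<And>g x. g \<in> carrier G \<Longrightarrow> x \<in> carrier M \<Longrightarrow> \<theta> (\<rho> g x) = A g (\<theta> x)"
    using ZG unfolding ZG_isomorphic_def by blast
  have \<theta>_add: "\<theta> (x \<otimes>\<^bsub>M\<^esub> y) = \<theta> x + \<theta> y" if "x \<in> carrier M" "y \<in> carrier M" for x y
    using \<theta> that by (auto simp: iso_def hom_def add_group_def)
  have \<theta>_onto: "\<theta> ` carrier M = L\<^sub>1"
    using \<theta> by (auto simp: iso_def bij_betw_def add_group_def)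
  have "free_Abelian_group {..<r} \<cong> M" using r by (rule M.iso_sym)
  then have "free_Abelian_group {..<r} \<cong> add_group \<lparr>carrier := L\<^sub>1\<rparr>"
    using \<theta> by (blast intro: iso_trans is_isoI)
  from symplectic_basis_of_splitting[OF assms(6) L isotropic this]
  obtain e f :: "'n \<Rightarrow> complex^'n" where "symplectic_basis H UNIV e f"
    and L1: "L\<^sub>1 = zmod.span (range e)" and L2: "L\<^sub>2 = zmod.span (range f)" by blast
  then interpret symplectic_basis H UNIV e f by blast

  have \<rho>_auto: "\<rho> g \<in> auto M" if "g \<in> carrier G" for g
    using hom_in_carrier[OF \<rho>_hom that] by (simp add: AutoGroup_def)
  have \<rho>_closed: "\<rho> g x \<in> carrier M" if "g \<in> carrier G" "x \<in> carrier M" for g x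
    using \<rho>_auto[OF that(1)] that(2) by (auto simp: auto_def hom_def)
  have \<rho>_mult: "\<rho> (g \<otimes>\<^bsub>G\<^esub> h) x = \<rho> g (\<rho> h x)"
    if "g \<in> carrier G" "h \<in> carrier G" "x \<in> carrier M" for g h x
    using hom_mult[OF \<rho>_hom that(1,2)] \<rho>_auto[OF that(1)] \<rho>_auto[OF that(2)] that(3)
    by (simp add: AutoGroup_def BijGroup_def auto_def compose_eq)
  have \<rho>_one: "\<rho> \<one>\<^bsub>G\<^esub> x = x" if "x \<in> carrier M" for x
    using hom_one[OF \<rho>_hom assms(1) M.AutoGroup] that by (simp add: AutoGroup_def BijGroup_def)
  have A_clinear: "clinear (A g)" if "g \<in> carrier G" for g
    using lift[OF that] by (simp add: linear_lift_def)
  have A_H: "H (A g x) (A g y) = H x y" if g: "g \<in> carrier G" for g x y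
  proof -
    have "\<alpha> g \<in> carrier (ppav_Aut \<Lambda> H)"
      using \<alpha> g by (auto simp: ppav_action_def hom_def)
    then obtain B where B: "linear_lift \<Lambda> (\<alpha> g) B" "\<And>x y. H (B x) (B y) = H x y"
      by (auto simp: ppav_Aut_def)
    then show ?thesis using linear_lift_unique[OF assms(6) lift[OF g] B(1)] by simp
  qed

  have cspan: "vec.span (\<theta> ` carrier M) = UNIV"
  proof -
    have "range e \<subseteq> \<theta> ` carrier M" unfolding \<theta>_onto L1 by (rule zmod.span_superset)
    then show ?thesis using vec.span_mono[of "range e"] cspan_e by blast
  qed
  have schur: "\<exists>z. \<forall>v. T v = z *s v"
    if "clinear T" "\<And>g v. g \<in> carrier G \<Longrightarrow> T (A g v) = A g (T v)" for T
    by (rule absolutely_irreducible_scalar[OF assms(5) M.m_closed \<rho>_closed \<theta>_add \<theta>_equiv cspan A_clinear that])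
  have "\<exists>z. Im z \<noteq> 0 \<and> (\<forall>i\<in>UNIV. z *s e i \<in> zmod.span (range f))"
  proof (rule intertwiner_scalar[OF assms(1,2) A_clinear A_H])
    fix g h x assume g: "g \<in> carrier G"
    show "A g x \<in> zmod.span (range e)" if "x \<in> zmod.span (range e)"
      using A_L[OF g] that unfolding L1 by blast
    show "A g x \<in> zmod.span (range f)" if "x \<in> zmod.span (range f)"
      using A_L[OF g] that unfolding L2 by blast
    assume h: "h \<in> carrier G" and "x \<in> zmod.span (range e)"
    then obtain m where m: "m \<in> carrier M" "x = \<theta> m" using \<theta>_onto L1 by blast
    interpret G: group G by (rule assms(1))
    show "A (g \<otimes>\<^bsub>G\<^esub> h) x = A g (A h x)"
      using g h m by (simp add: \<rho>_closed \<rho>_mult flip: \<theta>_equiv)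
  next
    fix x assume "x \<in> zmod.span (range e)"
    then obtain m where m: "m \<in> carrier M" "x = \<theta> m" using \<theta>_onto L1 by blast
    then show "A \<one>\<^bsub>G\<^esub> x = x"
      using \<theta>_equiv[of "\<one>\<^bsub>G\<^esub>" m] \<rho>_one group.is_monoid[OF assms(1)] by (simp add: monoid.one_closed)
  qed (assumption, assumption, rule schur)
  then obtain z where "Im z \<noteq> 0" "\<And>i. z *s e i \<in> zmod.span (range f)" by blast
  then show ?thesis
    using L(3) unfolding L1 L2 by (intro lattice_torus_isomorphic_product[OF cspan_e])
qed

end
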